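(* The quantum super Grassmannian $Gr_q$ is a quantum homogeneous superspace for the quantum supergroup $\mathrm{GL}_q(4|1)$; i.e., the comultiplication $\Delta$ of $\mathrm{GL}_q(4|1)$ restricts to a coaction $$\Delta|_{Gr_q}: Gr_q\longrightarrow \mathrm{GL}_q(4|1)\otimes Gr_q .$$
   Context: Let $\mathbb{C}_q=\mathbb{C}[q,q^{-1}]$. The quantum matrix superalgebra is $M_q(m|n)=\mathbb{C}_q\langle a_{ij}\rangle/I_M$, $1\le i,j\le m+n$, where $p(i)=0$ for $1\le i\le m$ and $p(i)=1$ otherwise, $\pi(a_{ij})=p(i)+p(j)$ is the parity of $a_{ij}$, and $I_M$ is generated by the relations $$a_{ij}a_{il}=(-1)^{\pi(a_{ij})\pi(a_{il})}q^{(-1)^{p(i)+1}}a_{il}a_{ij},\quad j<l,$$ $$a_{ij}a_{kj}=(-1)^{\pi(a_{ij})\pi(a_{kj})}q^{(-1)^{p(j)+1}}a_{kj}a_{ij},\quad i<k,$$ $$a_{ij}a_{kl}=(-1)^{\pi(a_{ij})\pi(a_{kl})}a_{kl}a_{ij},\quad i<k,\ j>l\ \text{ or }\ i>k,\ j<l,$$ $$a_{ij}a_{kl}-(-1)^{\pi(a_{ij})\pi(a_{kl})}a_{kl}a_{ij}=(-1)^{\pi(a_{ij})\pi(a_{kj})}(q^{-1}-q)a_{kj}a_{il},\quad i<k,\ j<l,$$ together with $a_{ij}^2=0$ for $a_{ij}$ odd. It is a (super) bialgebra with $\Delta(a_{ij})=\sum_k a_{ik}\otimes a_{kj}$ and counit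 $\epsilon(a_{ij})=\delta_{ij}$; tensor products of superalgebras carry the usual sign rule for multiplication. The quantum general linear supergroup is $\mathrm{GL}_q(m|n)=M_q(m|n)\langle D_1^{-1},D_2^{-1}\rangle$, where $D_1^{-1},D_2^{-1}$ are even two-sided inverses of the quantum determinants of the diagonal blocks $$D_1=\sum_{\sigma\in S_m}(-q)^{-l(\sigma)}a_{1\sigma(1)}\cdots a_{m\sigma(m)},\qquad D_2=\sum_{\sigma\in S_n}(-q)^{l(\sigma)}a_{m+1,m+\sigma(1)}\cdots a_{m+n,m+\sigma(n)},$$ with $l(\sigma)$ the length of $\sigma$. It is a Hopf superalgebra whose comultiplication and counit extend those of $M_q(m|n)$. The quantum super Grassmannian $Gr_q$ of $2|0$ planes in $4|1$ dimensional superspace is the $\mathbb{C}_q$-subalgebra of $\mathrm{GL}_q(4|1)$ generated by $$D_{ij}=a_{i1}a_{j2}-q^{-1}a_{i2}a_{j1}\ (1\le i<j\le 4),\quad D_{i5}=a_{i1}a_{52}-q^{-1}a_{i2}a_{51}\ (1\le i\le 4),\quad D_{55}=a_{51}a_{52}.$$ *)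

theory Defs
  imports Complex_Main "HOL-Library.Poly_Mapping" "HOL-Library.Numeral_Type" "HOL-Library.Z2"
    "HOL-Combinatorics.Permutations"
begin

section \<open>The ground ring and superalgebras over it\<close>

text \<open>The Laurent polynomial ring \<open>C[q, q\<^sup>-\<^sup>1]\<close> is the group ring of the integers over the
  complex numbers, with the convolution product of \<^theory>\<open>HOL-Library.Poly_Mapping\<close>.\<close>

type_synonym laurent = "int \<Rightarrow>\<^sub>0 complex"

definition qpow :: "int \<Rightarrow> laurent"  \<comment> \<open>the unit \<open>q ^ k\<close>\<close>
  where "qpow k = Poly_Mapping.single k 1"

class cq_module = ab_group_add +
  fixes cq_scale :: "laurent \<Rightarrow> 'a \<Rightarrow> 'a"  (infixr \<open>*\<^sub>q\<close> 75)
  assumes cq_scale_right_distrib: "c *\<^sub>q (x + y) = c *\<^sub>q x + c *\<^sub>q y"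
    and cq_scale_left_distrib: "(c + d) *\<^sub>q x = c *\<^sub>q x + d *\<^sub>q x"
    and cq_scale_scale: "c *\<^sub>q (d *\<^sub>q x) = (c * d) *\<^sub>q x"
    and cq_scale_one: "1 *\<^sub>q x = x"

text \<open>Unital associative algebras. The class \<^class>\<open>ring_1\<close> is avoided because it excludes the
  zero ring, and a tensor product of nonzero algebras may be zero.\<close>

class cq_algebra = cq_module + ring + monoid_mult +
  assumes cq_scale_mult_left: "(c *\<^sub>q x) * y = c *\<^sub>q (x * y)"
    and cq_scale_mult_right: "x * (c *\<^sub>q y) = c *\<^sub>q (x * y)"

text \<open>A grading by integers modulo 2 (\<open>0\<close> is even, \<open>1\<close> is odd) is given by the projections onto
  the two homogeneous components.\<close>

class cq_superalgebra = cq_algebra +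
  fixes spart :: "bit \<Rightarrow> 'a \<Rightarrow> 'a"
  assumes spart_add: "spart d (x + y) = spart d x + spart d y"
    and spart_scale: "spart d (c *\<^sub>q x) = c *\<^sub>q spart d x"
    and spart_decomp: "spart 0 x + spart 1 x = x"
    and spart_spart: "spart d (spart e x) = (if d = e then spart e x else 0)"
    and spart_mult: "spart (d + e) (spart d x * spart e y) = spart d x * spart e y"
    and spart_one: "spart 0 1 = 1"

definition ksign :: "bit \<Rightarrow> bit \<Rightarrow> laurent"  \<comment> \<open>the sign \<open>(-1) ^ (d e)\<close>\<close>
  where "ksign d e = (if d = 1 \<and> e = 1 then - 1 else 1)"

definition cq_linear :: "('a::cq_module \<Rightarrow> 'b::cq_module) \<Rightarrow> bool" where
  "cq_linear f \<longleftrightarrow> (\<forall>x y. f (x + y) = f x + f y) \<and> (\<forall>c x. f (c *\<^sub>q x) = c *\<^sub>q f x)"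

definition cq_bilinear :: "('a::cq_module \<Rightarrow> 'b::cq_module \<Rightarrow> 'c::cq_module) \<Rightarrow> bool" where
  "cq_bilinear f \<longleftrightarrow> (\<forall>a. cq_linear (f a)) \<and> (\<forall>b. cq_linear (\<lambda>a. f a b))"

definition superalgebra_hom_on ::
    "'a::cq_superalgebra set \<Rightarrow> ('a \<Rightarrow> 'b::cq_superalgebra) \<Rightarrow> bool" where
  "superalgebra_hom_on V f \<longleftrightarrow>
     (\<forall>x\<in>V. \<forall>y\<in>V. f (x + y) = f x + f y) \<and>
     (\<forall>c. \<forall>x\<in>V. f (c *\<^sub>q x) = c *\<^sub>q f x) \<and>
     (\<forall>x\<in>V. \<forall>y\<in>V. f (x * y) = f x * f y) \<and>
     f 1 = 1 \<and>
     (\<forall>d. \<forall>x\<in>V. f (spart d x) = spart d (f x))"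

abbreviation superalgebra_hom :: "('a::cq_superalgebra \<Rightarrow> 'b::cq_superalgebra) \<Rightarrow> bool" where
  "superalgebra_hom \<equiv> superalgebra_hom_on UNIV"

inductive_set cq_span :: "'a::cq_module set \<Rightarrow> 'a set" for S where
  zero: "0 \<in> cq_span S"
| base: "x \<in> S \<Longrightarrow> x \<in> cq_span S"
| add: "x \<in> cq_span S \<Longrightarrow> y \<in> cq_span S \<Longrightarrow> x + y \<in> cq_span S"
| scale: "x \<in> cq_span S \<Longrightarrow> c *\<^sub>q x \<in> cq_span S"

inductive_set cq_subalgebra :: "'a::cq_algebra set \<Rightarrow> 'a set" for S where
  base: "x \<in> S \<Longrightarrow> x \<in> cq_subalgebra S"
| one: "1 \<in> cq_subalgebra S"
| add: "x \<in> cq_subalgebra S \<Longrightarrow> y \<in> cq_subalgebra S \<Longrightarrow> x + y \<in> cq_subalgebra S"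
| mult: "x \<in> cq_subalgebra S \<Longrightarrow> y \<in> cq_subalgebra S \<Longrightarrow> x * y \<in> cq_subalgebra S"
| scale: "x \<in> cq_subalgebra S \<Longrightarrow> c *\<^sub>q x \<in> cq_subalgebra S"

lemma cq_scale_zero_right [simp]: "c *\<^sub>q (0::'a::cq_module) = 0"
  using cq_scale_right_distrib[of c 0 "0::'a"] by simp

lemma cq_scale_zero_left [simp]: "0 *\<^sub>q (x::'a::cq_module) = 0"
  using cq_scale_left_distrib[of 0 0 x] by simp

lemma cq_scale_minus_left: "(- c) *\<^sub>q (x::'a::cq_module) = - (c *\<^sub>q x)"
  using cq_scale_left_distrib[of c "- c" x] by (simp add: eq_neg_iff_add_eq_0 add.commute)

lemma cq_scale_minus_right: "c *\<^sub>q (- x::'a::cq_module) = - (c *\<^sub>q x)"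
  using cq_scale_right_distrib[of c x "- x"] by (simp add: eq_neg_iff_add_eq_0 add.commute)

lemma cq_scale_minus_one: "(- 1) *\<^sub>q (x::'a::cq_module) = - x"
  by (simp add: cq_scale_minus_left cq_scale_one)

lemma cq_scale_sum: "c *\<^sub>q (\<Sum>i\<in>A. f i :: 'a::cq_module) = (\<Sum>i\<in>A. c *\<^sub>q f i)"
  by (induction A rule: infinite_finite_induct) (auto simp: cq_scale_right_distrib)

lemma bit_add_self [simp]: "(d::bit) + d = 0" "(d::bit) + (d + e) = e"
  by (cases d; cases e; simp)+

lemma bit_add_eq_iff: "(d::bit) + e = c \<longleftrightarrow> d = c + e"
  by (cases d; cases e; cases c; simp)

lemma bit_all: "(\<forall>d::bit. P d) \<longleftrightarrow> P 0 \<and> P 1"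
  by (metis bit_not_zero_iff)

section \<open>Tensor products\<close>

text \<open>The tensor product is the free module on pairs modulo the usual bilinearity relations.\<close>

definition pm_scale :: "laurent \<Rightarrow> ('k \<Rightarrow>\<^sub>0 laurent) \<Rightarrow> ('k \<Rightarrow>\<^sub>0 laurent)" where
  "pm_scale c = Poly_Mapping.map ((*) c)"

inductive_set tensor_null :: "('a::cq_module \<times> 'b::cq_module \<Rightarrow>\<^sub>0 laurent) set" where
  zero: "0 \<in> tensor_null"
| add: "x \<in> tensor_null \<Longrightarrow> y \<in> tensor_null \<Longrightarrow> x + y \<in> tensor_null"
| scale: "x \<in> tensor_null \<Longrightarrow> pm_scale c x \<in> tensor_null"
| add_left: "Poly_Mapping.single (a + a', b) 1 - Poly_Mapping.single (a, b) 1
     - Poly_Mapping.single (a', b) 1 \<in> tensor_null"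
| add_right: "Poly_Mapping.single (a, b + b') 1 - Poly_Mapping.single (a, b) 1
     - Poly_Mapping.single (a, b') 1 \<in> tensor_null"
| scale_left: "Poly_Mapping.single (c *\<^sub>q a, b) 1 - Poly_Mapping.single (a, b) c \<in> tensor_null"
| scale_right: "Poly_Mapping.single (a, c *\<^sub>q b) 1 - Poly_Mapping.single (a, b) c \<in> tensor_null"

lemma lookup_pm_scale: "Poly_Mapping.lookup (pm_scale c x) k = c * Poly_Mapping.lookup x k"
  by (simp add: pm_scale_def Poly_Mapping.map.rep_eq when_def)

lemma pm_scale_simps [simp]:
  "pm_scale c (x + y) = pm_scale c x + pm_scale c y"
  "pm_scale c (x - y) = pm_scale c x - pm_scale c y"
  "pm_scale (c + d) x = pm_scale c x + pm_scale d x"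
  "pm_scale c (pm_scale d x) = pm_scale (c * d) x"
  "pm_scale 1 x = x"
  "pm_scale (- 1) x = - x"
  "pm_scale c (Poly_Mapping.single k d) = Poly_Mapping.single k (c * d)"
  by (rule poly_mapping_eqI; simp add: lookup_pm_scale lookup_add lookup_minus algebra_simps
      lookup_single when_def)+

lemma tensor_null_uminus: "x \<in> tensor_null \<Longrightarrow> - x \<in> tensor_null"
  using tensor_null.scale[of x "- 1"] by simp

lemma tensor_null_diff: "x \<in> tensor_null \<Longrightarrow> y \<in> tensor_null \<Longrightarrow> x - y \<in> tensor_null"
  using tensor_null.add[of x "- y"] tensor_null_uminus by auto

quotient_type (overloaded) ('a, 'b) tensor = "'a::cq_module \<times> 'b::cq_module \<Rightarrow>\<^sub>0 laurent" /
  "\<lambda>x y. x - y \<in> tensor_null"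
proof (rule equivpI)
  show "reflp (\<lambda>x y. x - y \<in> tensor_null)"
    by (rule reflpI) (simp add: tensor_null.zero)
  show "symp (\<lambda>x y. x - y \<in> tensor_null)"
    by (rule sympI) (use tensor_null_uminus in fastforce)
  show "transp (\<lambda>x y. x - y \<in> tensor_null)"
    by (rule transpI) (use tensor_null.add in fastforce)
qed

instantiation tensor :: (cq_module, cq_module) cq_module
begin

lift_definition zero_tensor :: "('a, 'b) tensor" is 0 .

lift_definition plus_tensor :: "('a, 'b) tensor \<Rightarrow> ('a, 'b) tensor \<Rightarrow> ('a, 'b) tensor"
  is "(+)" by (metis add_diff_add tensor_null.add)

lift_definition minus_tensor :: "('a, 'b) tensor \<Rightarrow> ('a, 'b) tensor \<Rightarrow> ('a, 'b) tensor"
  is "(-)"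
proof -
  fix a b c d :: "'a \<times> 'b \<Rightarrow>\<^sub>0 laurent"
  assume "a - b \<in> tensor_null" "c - d \<in> tensor_null"
  hence "(a - b) - (c - d) \<in> tensor_null" by (rule tensor_null_diff)
  thus "a - c - (b - d) \<in> tensor_null" by (simp add: algebra_simps)
qed

lift_definition uminus_tensor :: "('a, 'b) tensor \<Rightarrow> ('a, 'b) tensor"
  is uminus
proof -
  fix a b :: "'a \<times> 'b \<Rightarrow>\<^sub>0 laurent"
  assume "a - b \<in> tensor_null"
  hence "- (a - b) \<in> tensor_null" by (rule tensor_null_uminus)
  thus "- a - - b \<in> tensor_null" by (simp add: algebra_simps)
qed

lift_definition cq_scale_tensor :: "laurent \<Rightarrow> ('a, 'b) tensor \<Rightarrow> ('a, 'b) tensor"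
  is pm_scale by (metis pm_scale_simps(2) tensor_null.scale)

instance
  by standard (transfer; simp add: algebra_simps tensor_null.zero)+

end

lift_definition tensor_pure :: "'a::cq_module \<Rightarrow> 'b::cq_module \<Rightarrow> ('a, 'b) tensor"
    (infixl \<open>\<otimes>\<^sub>q\<close> 72)
  is "\<lambda>a b. Poly_Mapping.single (a, b) 1" .

text \<open>The linear map induced by a bilinear map. The definition goes through a chosen
  representative and is meaningful only for bilinear arguments.\<close>

definition free_ext :: "('k \<Rightarrow> 'c::cq_module) \<Rightarrow> ('k \<Rightarrow>\<^sub>0 laurent) \<Rightarrow> 'c" where
  "free_ext f x = (\<Sum>k\<in>Poly_Mapping.keys x. Poly_Mapping.lookup x k *\<^sub>q f k)"

definition tlift ::
    "('a::cq_module \<Rightarrow> 'b::cq_module \<Rightarrow> 'c::cq_module) \<Rightarrow> ('a, 'b) tensor \<Rightarrow> 'c" where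
  "tlift f t = free_ext (\<lambda>(a, b). f a b) (rep_tensor t)"

definition tmap :: "('a::cq_module \<Rightarrow> 'c::cq_module) \<Rightarrow> ('b::cq_module \<Rightarrow> 'd::cq_module) \<Rightarrow>
    ('a, 'b) tensor \<Rightarrow> ('c, 'd) tensor" where
  "tmap f g = tlift (\<lambda>a b. f a \<otimes>\<^sub>q g b)"

definition tassoc :: "(('a::cq_module, 'b::cq_module) tensor, 'c::cq_module) tensor \<Rightarrow>
    ('a, ('b, 'c) tensor) tensor" where
  "tassoc = tlift (\<lambda>t c. tlift (\<lambda>a b. a \<otimes>\<^sub>q (b \<otimes>\<^sub>q c)) t)"

text \<open>The tensor product of two submodules \<open>A\<close> and \<open>B\<close>, as a submodule of the tensor product of
  the ambient modules: the image of the canonical map from the abstract tensor product. That map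
  is injective when \<open>A\<close> is the whole ambient module and this is torsion-free, since the ground
  ring is a principal ideal domain.\<close>

definition tensor_sub :: "'a::cq_module set \<Rightarrow> 'b::cq_module set \<Rightarrow> ('a, 'b) tensor set" where
  "tensor_sub A B = cq_span {a \<otimes>\<^sub>q b |a b. a \<in> A \<and> b \<in> B}"

lemma free_ext_superset:
  assumes "finite K" "Poly_Mapping.keys x \<subseteq> K"
  shows "free_ext f x = (\<Sum>k\<in>K. Poly_Mapping.lookup x k *\<^sub>q f k)"
  unfolding free_ext_def using assms
  by (intro sum.mono_neutral_left) (auto simp: in_keys_iff)

lemma free_ext_add: "free_ext f (x + y) = free_ext f x + free_ext f y"
proof -
  let ?K = "Poly_Mapping.keys x \<union> Poly_Mapping.keys y"
  have "free_ext f z = (\<Sum>k\<in>?K. Poly_Mapping.lookup z k *\<^sub>q f k)" if "z \<in> {x, y, x + y}" for z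
    using that Poly_Mapping.keys_add[of x y] by (intro free_ext_superset) auto
  thus ?thesis
    by (simp add: lookup_add cq_scale_left_distrib sum.distrib)
qed

lemma free_ext_scale: "free_ext f (pm_scale c x) = c *\<^sub>q free_ext f x"
proof -
  have "Poly_Mapping.keys (pm_scale c x) \<subseteq> Poly_Mapping.keys x"
    by (auto simp: in_keys_iff lookup_pm_scale)
  hence "free_ext f (pm_scale c x)
      = (\<Sum>k\<in>Poly_Mapping.keys x. Poly_Mapping.lookup (pm_scale c x) k *\<^sub>q f k)"
    by (intro free_ext_superset) auto
  thus ?thesis
    by (simp add: free_ext_def lookup_pm_scale cq_scale_sum cq_scale_scale)
qed

lemma free_ext_uminus: "free_ext f (- x) = - free_ext f x"
  using free_ext_scale[of f "- 1" x] by (simp add: cq_scale_minus_one)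

lemma free_ext_diff: "free_ext f (x - y) = free_ext f x - free_ext f y"
  using free_ext_add[of f x "- y"] by (simp add: free_ext_uminus)

lemma free_ext_zero [simp]: "free_ext f 0 = 0"
  by (simp add: free_ext_def)

lemma free_ext_single: "free_ext f (Poly_Mapping.single k c) = c *\<^sub>q f k"
  by (simp add: free_ext_def)

lemma cq_linearI:
  assumes "\<And>x y. f (x + y) = f x + f y" "\<And>c x. f (c *\<^sub>q x) = c *\<^sub>q f x"
  shows "cq_linear f"
  using assms by (simp add: cq_linear_def)

lemma cq_bilinearD:
  assumes "cq_bilinear f"
  shows "f (a + a') b = f a b + f a' b" "f a (b + b') = f a b + f a b'"
    "f (c *\<^sub>q a) b = c *\<^sub>q f a b" "f a (c *\<^sub>q b) = c *\<^sub>q f a b"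
  using assms unfolding cq_bilinear_def cq_linear_def by auto

lemma free_ext_tensor_null:
  assumes "cq_bilinear f" "x \<in> tensor_null"
  shows "free_ext (\<lambda>(a, b). f a b) x = 0"
  using assms(2)
  by induction (simp_all add: free_ext_add free_ext_scale free_ext_diff free_ext_single
      cq_scale_one cq_bilinearD[OF assms(1)])

lemma tlift_abs:
  assumes "cq_bilinear f"
  shows "tlift f (abs_tensor x) = free_ext (\<lambda>(a, b). f a b) x"
proof -
  have "rep_tensor (abs_tensor x) - x \<in> tensor_null"
    using Quotient3_rep_abs[OF Quotient3_tensor, of x] by (simp add: tensor_null.zero)
  hence "free_ext (\<lambda>(a, b). f a b) (rep_tensor (abs_tensor x) - x) = 0"
    by (rule free_ext_tensor_null[OF assms])
  thus ?thesis by (simp add: tlift_def free_ext_diff)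
qed

lemma tlift_pure: "cq_bilinear f \<Longrightarrow> tlift f (a \<otimes>\<^sub>q b) = f a b"
  by (simp add: tensor_pure.abs_eq tlift_abs free_ext_single cq_scale_one)

lemma tlift_add:
  assumes "cq_bilinear f" shows "tlift f (s + t) = tlift f s + tlift f t"
  by (induction s rule: tensor.abs_induct, induction t rule: tensor.abs_induct)
    (simp add: plus_tensor.abs_eq tlift_abs[OF assms] free_ext_add)

lemma tlift_scale:
  assumes "cq_bilinear f" shows "tlift f (c *\<^sub>q t) = c *\<^sub>q tlift f t"
  by (induction t rule: tensor.abs_induct)
    (simp add: cq_scale_tensor.abs_eq tlift_abs[OF assms] free_ext_scale)

lemma tensor_bilinear:
  "(a + a') \<otimes>\<^sub>q b = a \<otimes>\<^sub>q b + a' \<otimes>\<^sub>q b" "a \<otimes>\<^sub>q (b + b') = a \<otimes>\<^sub>q b + a \<otimes>\<^sub>q b'"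
  "(c *\<^sub>q a) \<otimes>\<^sub>q b = c *\<^sub>q (a \<otimes>\<^sub>q b)" "a \<otimes>\<^sub>q (c *\<^sub>q b) = c *\<^sub>q (a \<otimes>\<^sub>q b)"
  by (transfer, metis diff_diff_eq tensor_null.add_left)
    (transfer, metis diff_diff_eq tensor_null.add_right,
     (transfer, simp add: tensor_null.scale_left tensor_null.scale_right)+)

lemma tensor_zero [simp]: "0 \<otimes>\<^sub>q b = 0" "a \<otimes>\<^sub>q 0 = 0"
  using tensor_bilinear(3)[of 0 0 b] tensor_bilinear(4)[of a 0 0] by simp_all

lemma poly_mapping_single_induct [case_names zero add]:
  fixes x :: "'k \<Rightarrow>\<^sub>0 'b::monoid_add"
  assumes "P 0" "\<And>k c x. P x \<Longrightarrow> P (Poly_Mapping.single k c + x)"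
  shows "P x"
proof (induction x rule: update_induct)
  case const
  then show ?case by (rule assms(1))
next
  case (update f a b)
  have "Poly_Mapping.update a b f = Poly_Mapping.single a b + f"
    using update(1) by (intro poly_mapping_eqI) (auto simp: lookup_update lookup_add lookup_single
        when_def in_keys_iff)
  with assms(2)[OF update(3)] show ?case by simp
qed

lemma tensor_induct [case_names zero pure add]:
  assumes "P 0" "\<And>a b. P (a \<otimes>\<^sub>q b)" "\<And>s t. P s \<Longrightarrow> P t \<Longrightarrow> P (s + t)"
  shows "P t"
proof (induction t rule: tensor.abs_induct)
  case (1 x)
  show ?case
  proof (induction x rule: poly_mapping_single_induct)
    case zero
    then show ?case using assms(1) by (simp add: zero_tensor.abs_eq)
  next
    case (add k c x)
    obtain a b where k: "k = (a, b)" by (cases k)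
    have "abs_tensor (Poly_Mapping.single k c) = (c *\<^sub>q a) \<otimes>\<^sub>q b"
      unfolding k tensor_bilinear(3) by (simp add: tensor_pure.abs_eq cq_scale_tensor.abs_eq)
    thus ?case
      using assms(3)[OF assms(2)[of "c *\<^sub>q a" b] add] by (metis plus_tensor.abs_eq)
  qed
qed

lemma tlift_zero: "cq_bilinear f \<Longrightarrow> tlift f 0 = 0"
  using tlift_scale[of f 0 0] by simp

lemma tlift_param_add:
  assumes "cq_bilinear f" "cq_bilinear g" "cq_bilinear h" "\<And>a b. f a b = g a b + h a b"
  shows "tlift f t = tlift g t + tlift h t"
proof (induction t rule: tensor_induct)
  case zero
  show ?case by (simp only: tlift_zero[OF assms(1)] tlift_zero[OF assms(2)]
        tlift_zero[OF assms(3)] add_0)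
next
  case (pure a b)
  show ?case unfolding tlift_pure[OF assms(1)] tlift_pure[OF assms(2)] tlift_pure[OF assms(3)]
    by (rule assms(4))
next
  case (add s t)
  show ?case unfolding tlift_add[OF assms(1)] tlift_add[OF assms(2)] tlift_add[OF assms(3)] add
    by (simp only: add_ac)
qed

lemma tlift_param_scale:
  assumes "cq_bilinear f" "cq_bilinear g" "\<And>a b. f a b = c *\<^sub>q g a b"
  shows "tlift f t = c *\<^sub>q tlift g t"
proof (induction t rule: tensor_induct)
  case zero
  show ?case by (simp only: tlift_zero[OF assms(1)] tlift_zero[OF assms(2)] cq_scale_zero_right)
next
  case (pure a b)
  show ?case unfolding tlift_pure[OF assms(1)] tlift_pure[OF assms(2)] by (rule assms(3))
next
  case (add s t)
  show ?case unfolding tlift_add[OF assms(1)] tlift_add[OF assms(2)] add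
    by (simp only: cq_scale_right_distrib)
qed

text \<open>The sign rule: \<open>(a \<otimes> b) (a' \<otimes> b') = (-1) ^ (|b| |a'|) a a' \<otimes> b b'\<close> for homogeneous \<open>b\<close> and
  \<open>a'\<close>, extended bilinearly by splitting \<open>b\<close> and \<open>a'\<close> into homogeneous components.\<close>

definition tmul_pure :: "'a::cq_superalgebra \<Rightarrow> 'b::cq_superalgebra \<Rightarrow> 'a \<Rightarrow> 'b \<Rightarrow> ('a, 'b) tensor" where
  "tmul_pure a b a' b' =
     (\<Sum>d\<in>{0, 1}. \<Sum>e\<in>{0, 1}. ksign d e *\<^sub>q ((a * spart e a') \<otimes>\<^sub>q (spart d b * b')))"

instantiation tensor :: (cq_superalgebra, cq_superalgebra) "{times, one}"
begin

definition one_tensor :: "('a, 'b) tensor" where "one_tensor = 1 \<otimes>\<^sub>q 1"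

definition times_tensor :: "('a, 'b) tensor \<Rightarrow> ('a, 'b) tensor \<Rightarrow> ('a, 'b) tensor" where
  "times_tensor t u = tlift (\<lambda>a b. tlift (tmul_pure a b) u) t"

instance ..

end

lemma spart_homogeneous:
  "spart d a = a \<Longrightarrow> spart e (a::'a::cq_superalgebra) = (if e = d then a else 0)"
  by (metis spart_spart)

lemma spart_mult_homogeneous:
  "spart d a = a \<Longrightarrow> spart e b = b \<Longrightarrow> spart (d + e) (a * b) = (a * b :: 'a::cq_superalgebra)"
  by (metis spart_mult)

lemma tensor_induct_homogeneous [case_names zero pure add]:
  fixes t :: "('a::cq_superalgebra, 'b::cq_superalgebra) tensor"
  assumes "P 0" "\<And>a b d e. spart d a = a \<Longrightarrow> spart e b = b \<Longrightarrow> P (a \<otimes>\<^sub>q b)"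
    "\<And>s t. P s \<Longrightarrow> P t \<Longrightarrow> P (s + t)"
  shows "P t"
proof (induction t rule: tensor_induct)
  case (pure a b)
  have "a \<otimes>\<^sub>q b = (spart 0 a + spart 1 a) \<otimes>\<^sub>q (spart 0 b + spart 1 b)"
    by (simp only: spart_decomp)
  also have "\<dots> = spart 0 a \<otimes>\<^sub>q spart 0 b + spart 0 a \<otimes>\<^sub>q spart 1 b
      + (spart 1 a \<otimes>\<^sub>q spart 0 b + spart 1 a \<otimes>\<^sub>q spart 1 b)"
    by (simp only: tensor_bilinear add_ac)
  finally show ?case
    by (metis assms(2,3) spart_spart)
qed (use assms in auto)

lemma tmul_pure_linear:
  "tmul_pure (a + a2) b a' b' = tmul_pure a b a' b' + tmul_pure a2 b a' b'"
  "tmul_pure a (b + b2) a' b' = tmul_pure a b a' b' + tmul_pure a b2 a' b'"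
  "tmul_pure a b (a' + a2) b' = tmul_pure a b a' b' + tmul_pure a b a2 b'"
  "tmul_pure a b a' (b' + b2) = tmul_pure a b a' b' + tmul_pure a b a' b2"
  "tmul_pure (c *\<^sub>q a) b a' b' = c *\<^sub>q tmul_pure a b a' b'"
  "tmul_pure a (c *\<^sub>q b) a' b' = c *\<^sub>q tmul_pure a b a' b'"
  "tmul_pure a b (c *\<^sub>q a') b' = c *\<^sub>q tmul_pure a b a' b'"
  "tmul_pure a b a' (c *\<^sub>q b') = c *\<^sub>q tmul_pure a b a' b'"
  by (simp_all add: tmul_pure_def spart_add spart_scale distrib_left distrib_right tensor_bilinear
      cq_scale_right_distrib cq_scale_mult_right cq_scale_mult_left cq_scale_scale mult.commute add_ac)

lemma times_tensor_inner_bilinear: "cq_bilinear (tmul_pure a b)"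
  by (simp add: cq_bilinear_def cq_linear_def tmul_pure_linear)

lemma times_tensor_outer_bilinear: "cq_bilinear (\<lambda>a b. tlift (tmul_pure a b) u)"
  unfolding cq_bilinear_def cq_linear_def
  by (intro allI conjI; rule tlift_param_add tlift_param_scale;
      (rule times_tensor_inner_bilinear tmul_pure_linear)+)

lemma times_tensor_add_left:
  fixes t :: "('a::cq_superalgebra, 'b::cq_superalgebra) tensor"
  shows "(s + t) * u = s * u + t * u"
  unfolding times_tensor_def by (rule tlift_add[OF times_tensor_outer_bilinear])

lemma times_tensor_scale_left:
  fixes t :: "('a::cq_superalgebra, 'b::cq_superalgebra) tensor"
  shows "(c *\<^sub>q t) * u = c *\<^sub>q (t * u)"
  unfolding times_tensor_def by (rule tlift_scale[OF times_tensor_outer_bilinear])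

lemma times_tensor_zero_left:
  fixes u :: "('a::cq_superalgebra, 'b::cq_superalgebra) tensor"
  shows "0 * u = 0"
  using times_tensor_scale_left[of 0 0 u] by simp

lemma times_tensor_pure_left: "(a \<otimes>\<^sub>q b) * u = tlift (tmul_pure a b) u"
  unfolding times_tensor_def by (rule tlift_pure[OF times_tensor_outer_bilinear])

lemma times_tensor_right:
  fixes s :: "('a::cq_superalgebra, 'b::cq_superalgebra) tensor"
  shows "s * (t + u) = s * t + s * u" "s * (c *\<^sub>q t) = c *\<^sub>q (s * t)"
  by (induction s rule: tensor_induct)
    (simp_all add: times_tensor_zero_left times_tensor_add_left times_tensor_pure_left
      tlift_add[OF times_tensor_inner_bilinear] tlift_scale[OF times_tensor_inner_bilinear]
      add_ac cq_scale_right_distrib)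

lemma times_tensor_zero_right:
  fixes u :: "('a::cq_superalgebra, 'b::cq_superalgebra) tensor"
  shows "u * 0 = 0"
  using times_tensor_right(2)[of u 0 0] by simp

lemma times_tensor_pure:
  assumes "spart d b = b" "spart e a' = a'"
  shows "(a \<otimes>\<^sub>q b) * (a' \<otimes>\<^sub>q b') = ksign d e *\<^sub>q ((a * a') \<otimes>\<^sub>q (b * b'))"
  by (cases d; cases e)
    (simp_all add: times_tensor_pure_left tlift_pure[OF times_tensor_inner_bilinear] tmul_pure_def
      spart_homogeneous[OF assms(1)] spart_homogeneous[OF assms(2)])

lemmas times_tensor_simps = times_tensor_add_left times_tensor_scale_left times_tensor_zero_left
  times_tensor_right times_tensor_zero_right

text \<open>The total degree of a tensor is the sum of the degrees of its factors.\<close>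

definition spart_pure ::
    "bit \<Rightarrow> 'a::cq_superalgebra \<Rightarrow> 'b::cq_superalgebra \<Rightarrow> ('a, 'b) tensor" where
  "spart_pure d a b = (\<Sum>e\<in>{0, 1}. spart e a \<otimes>\<^sub>q spart (d + e) b)"

lemma spart_pure_bilinear: "cq_bilinear (spart_pure d)"
  unfolding cq_bilinear_def cq_linear_def
  by (simp add: spart_pure_def spart_add spart_scale tensor_bilinear cq_scale_right_distrib add_ac)

instantiation tensor :: (cq_superalgebra, cq_superalgebra) cq_superalgebra
begin

definition spart_tensor :: "bit \<Rightarrow> ('a, 'b) tensor \<Rightarrow> ('a, 'b) tensor" where
  "spart_tensor d = tlift (spart_pure d)"

instance
proof
  fix x y z :: "('a, 'b) tensor" and c :: laurent and d e :: bit
  note bil = spart_pure_bilinear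
  show sadd: "spart d (x + y) = spart d x + spart d y" for d and x y :: "('a, 'b) tensor"
    unfolding spart_tensor_def by (rule tlift_add[OF bil])
  show sscale: "spart d (c *\<^sub>q x) = c *\<^sub>q spart d x" for d and x :: "('a, 'b) tensor" and c
    unfolding spart_tensor_def by (rule tlift_scale[OF bil])
  have szero: "spart d (0::('a, 'b) tensor) = 0" for d
    using sscale[of d 0 0] by simp
  have spure: "spart d (a \<otimes>\<^sub>q b) = (if d = i + j then a \<otimes>\<^sub>q b else 0)"
    if "spart i a = a" "spart j b = b" for d i j and a :: 'a and b :: 'b
    unfolding spart_tensor_def
    by (cases i; cases j; cases d) (simp_all add: tlift_pure[OF bil] spart_pure_def spart_homogeneous[OF that(1)]
        spart_homogeneous[OF that(2)])
  show "x * y * z = x * (y * z)"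
  proof (induction x rule: tensor_induct_homogeneous)
    case 1: (pure a b d e)
    show ?case
    proof (induction y rule: tensor_induct_homogeneous)
      case 2: (pure a' b' d' e')
      show ?case
      proof (induction z rule: tensor_induct_homogeneous)
        case 3: (pure a'' b'' d'' e'')
        have m: "spart (e + e') (b * b') = b * b'" "spart (d' + d'') (a' * a'') = a' * a''"
          using spart_mult_homogeneous[OF 1(2) 2(2)] spart_mult_homogeneous[OF 2(1) 3(1)] by this
        show ?case
          by (cases e; cases e'; cases d'; cases d'')
            (simp_all add: times_tensor_pure[OF 1(2) 2(1)] times_tensor_pure[OF 2(2) 3(1)]
              times_tensor_pure[OF m(1) 3(1)] times_tensor_pure[OF 1(2) m(2)]
              times_tensor_simps cq_scale_scale mult.assoc, simp_all add: ksign_def cq_scale_one)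
      qed (simp_all add: times_tensor_simps)
    qed (simp_all add: times_tensor_simps)
  qed (simp_all add: times_tensor_simps)
  show "(x + y) * z = x * z + y * z" "x * (y + z) = x * y + x * z"
    "(c *\<^sub>q x) * y = c *\<^sub>q (x * y)" "x * (c *\<^sub>q y) = c *\<^sub>q (x * y)"
    by (simp_all add: times_tensor_simps)
  show "1 * x = x"
    by (induction x rule: tensor_induct_homogeneous)
      (simp_all add: times_tensor_simps one_tensor_def times_tensor_pure[OF spart_one]
        ksign_def cq_scale_one)
  show "x * 1 = x"
    by (induction x rule: tensor_induct_homogeneous)
      (simp_all add: times_tensor_simps one_tensor_def times_tensor_pure[OF _ spart_one]
        ksign_def cq_scale_one)
  show "spart 0 (1::('a, 'b) tensor) = 1"
    using spure[OF spart_one spart_one, of 0] by (simp add: one_tensor_def)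
  show "spart 0 x + spart 1 x = x"
  proof (induction x rule: tensor_induct_homogeneous)
    case (pure a b i j)
    then show ?case by (cases i; cases j) (simp_all add: spure[OF pure])
  next
    case (add s t)
    have "spart 0 (s + t) + spart 1 (s + t) = (spart 0 s + spart 1 s) + (spart 0 t + spart 1 t)"
      by (simp only: sadd add_ac)
    then show ?case by (simp only: add)
  qed (simp add: szero)
  show "spart d (spart e x) = (if d = e then spart e x else 0)"
    by (induction x rule: tensor_induct_homogeneous) (auto simp: spure szero sadd)
  show "spart (d + e) (spart d x * spart e y) = spart d x * spart e y"
  proof (induction x rule: tensor_induct_homogeneous)
    case 1: (pure a b i j)
    show ?case
    proof (induction y rule: tensor_induct_homogeneous)
      case 2: (pure a' b' i' j')
      have m: "spart (i + i') (a * a') = a * a'" "spart (j + j') (b * b') = b * b'"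
        using spart_mult_homogeneous[OF 1(1) 2(1)] spart_mult_homogeneous[OF 1(2) 2(2)] by this
      have add4: "i + j + (i' + j') = i + i' + (j + j')" by (simp only: add_ac)
      show ?case
      proof (cases "d = i + j \<and> e = i' + j'")
        case True
        have "spart (i + i' + (j + j')) ((a * a') \<otimes>\<^sub>q (b * b')) = (a * a') \<otimes>\<^sub>q (b * b')"
          by (simp only: spure[OF m] if_True simp_thms)
        then show ?thesis
          using True by (simp only: spure[OF 1] spure[OF 2] simp_thms if_True add4
              times_tensor_pure[OF 1(2) 2(1)] sscale)
      qed (auto simp: spure[OF 1] spure[OF 2] szero times_tensor_simps)
    qed (simp_all add: szero sadd times_tensor_simps)
  qed (simp_all add: szero sadd times_tensor_simps)
qed

end

section \<open>The quantum general linear supergroup\<close>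

inductive_set two_sided_ideal :: "'a::ring_1 set \<Rightarrow> 'a set" for R where
  base: "r \<in> R \<Longrightarrow> r \<in> two_sided_ideal R"
| zero: "0 \<in> two_sided_ideal R"
| add: "x \<in> two_sided_ideal R \<Longrightarrow> y \<in> two_sided_ideal R \<Longrightarrow> x + y \<in> two_sided_ideal R"
| left: "x \<in> two_sided_ideal R \<Longrightarrow> a * x \<in> two_sided_ideal R"
| right: "x \<in> two_sided_ideal R \<Longrightarrow> x * a \<in> two_sided_ideal R"

text \<open>Lists form the free monoid, so \<open>'x list \<Rightarrow>\<^sub>0 laurent\<close> with its convolution product is
  the free unital associative algebra on \<open>'x\<close>.\<close>

instantiation list :: (type) monoid_add
begin
definition zero_list :: "'a list" where "zero_list = []"
definition plus_list :: "'a list \<Rightarrow> 'a list \<Rightarrow> 'a list" where "plus_list = (@)"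
instance by standard (simp_all add: zero_list_def plus_list_def)
end

text \<open>The numbers \<open>m\<close> and \<open>n\<close> are the cardinalities of two finite types, e.g.\ the numeral types
  \<open>4\<close> and \<open>1\<close>; the indices are the natural numbers from \<open>1\<close> to \<open>m + n\<close>.\<close>

typedef ('m::finite, 'n::finite) idx = "{1..CARD('m) + CARD('n)}"
  by (rule exI[of _ 1]) (simp add: Suc_leI trans_le_add1)

datatype ('m::finite, 'n::finite) gl_gen = Gen_a "('m, 'n) idx" "('m, 'n) idx" | Gen_D1inv | Gen_D2inv

type_synonym ('m, 'n) gl_free = "('m, 'n) gl_gen list \<Rightarrow>\<^sub>0 laurent"

definition idx_parity :: "nat \<Rightarrow> nat \<Rightarrow> bit"
  where "idx_parity m i = (if i \<le> m then 0 else 1)"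

definition a_parity :: "nat \<Rightarrow> nat \<Rightarrow> nat \<Rightarrow> bit"
  where "a_parity m i j = idx_parity m i + idx_parity m j"

fun gen_parity :: "('m::finite, 'n::finite) gl_gen \<Rightarrow> bit" where
  "gen_parity (Gen_a i j) = a_parity CARD('m) (Rep_idx i) (Rep_idx j)"
| "gen_parity Gen_D1inv = 0"
| "gen_parity Gen_D2inv = 0"

definition word_parity :: "('m::finite, 'n::finite) gl_gen list \<Rightarrow> bit"
  where "word_parity w = sum_list (map gen_parity w)"

definition fconst :: "laurent \<Rightarrow> ('m::finite, 'n::finite) gl_free"
  where "fconst c = Poly_Mapping.single [] c"

definition fgen :: "('m::finite, 'n::finite) gl_gen \<Rightarrow> ('m, 'n) gl_free"
  where "fgen g = Poly_Mapping.single [g] 1"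

definition fa :: "nat \<Rightarrow> nat \<Rightarrow> ('m::finite, 'n::finite) gl_free"
  where "fa i j = fgen (Gen_a (Abs_idx i) (Abs_idx j))"

definition perm_length :: "nat \<Rightarrow> (nat \<Rightarrow> nat) \<Rightarrow> nat"
  where "perm_length r \<sigma> = card {(i, j). 1 \<le> i \<and> i < j \<and> j \<le> r \<and> \<sigma> j < \<sigma> i}"

definition fD1 :: "('m::finite, 'n::finite) gl_free" where
  "fD1 = (\<Sum>\<sigma> | \<sigma> permutes {1..CARD('m)}.
     fconst ((- 1) ^ perm_length CARD('m) \<sigma> * qpow (- int (perm_length CARD('m) \<sigma>)))
       * prod_list (map (\<lambda>i. fa i (\<sigma> i)) [1..<Suc CARD('m)]))"

definition fD2 :: "('m::finite, 'n::finite) gl_free" where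
  "fD2 = (\<Sum>\<sigma> | \<sigma> permutes {1..CARD('n)}.
     fconst ((- 1) ^ perm_length CARD('n) \<sigma> * qpow (int (perm_length CARD('n) \<sigma>)))
       * prod_list (map (\<lambda>i. fa (CARD('m) + i) (CARD('m) + \<sigma> i)) [1..<Suc CARD('n)]))"

text \<open>Each relation \<open>x = y\<close> is encoded as the element \<open>x - y\<close> of the free algebra.\<close>

definition mq_relators :: "('m::finite, 'n::finite) gl_free set" where
  "mq_relators = (let m = CARD('m); I = {1..CARD('m) + CARD('n)}; p = idx_parity m;
       s = (\<lambda>i j k l. ksign (a_parity m i j) (a_parity m k l)) in
     {fa i j * fa i l
        - fconst (s i j i l * qpow (if p i = 0 then - 1 else 1)) * fa i l * fa i j
        |i j l. i \<in> I \<and> j \<in> I \<and> l \<in> I \<and> j < l}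
   \<union> {fa i j * fa k j
        - fconst (s i j k j * qpow (if p j = 0 then - 1 else 1)) * fa k j * fa i j
        |i j k. i \<in> I \<and> j \<in> I \<and> k \<in> I \<and> i < k}
   \<union> {fa i j * fa k l - fconst (s i j k l) * fa k l * fa i j
        |i j k l. i \<in> I \<and> j \<in> I \<and> k \<in> I \<and> l \<in> I \<and> (i < k \<and> j > l \<or> i > k \<and> j < l)}
   \<union> {fa i j * fa k l - fconst (s i j k l) * fa k l * fa i j
        - fconst (s i j k j * (qpow (- 1) - qpow 1)) * fa k j * fa i l
        |i j k l. i \<in> I \<and> j \<in> I \<and> k \<in> I \<and> l \<in> I \<and> i < k \<and> j < l}
   \<union> {fa i j * fa i j |i j. i \<in> I \<and> j \<in> I \<and> a_parity m i j = 1})"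

definition glq_relators :: "('m::finite, 'n::finite) gl_free set" where
  "glq_relators = mq_relators \<union>
     {fD1 * fgen Gen_D1inv - 1, fgen Gen_D1inv * fD1 - 1,
      fD2 * fgen Gen_D2inv - 1, fgen Gen_D2inv * fD2 - 1}"

lemma two_sided_ideal_uminus: "x \<in> two_sided_ideal R \<Longrightarrow> - x \<in> two_sided_ideal R"
  using two_sided_ideal.left[of x R "- 1"] by simp

lemma two_sided_ideal_diff:
  "x \<in> two_sided_ideal R \<Longrightarrow> y \<in> two_sided_ideal R \<Longrightarrow> x - y \<in> two_sided_ideal R"
  using two_sided_ideal.add[of x R "- y"] two_sided_ideal_uminus by auto

quotient_type (overloaded) ('m, 'n) glq = "('m::finite, 'n::finite) gl_free" /
  "\<lambda>x y. x - y \<in> two_sided_ideal glq_relators"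
proof (rule equivpI)
  show "reflp (\<lambda>x y. x - y \<in> two_sided_ideal glq_relators)"
    by (rule reflpI) (simp add: two_sided_ideal.zero)
  show "symp (\<lambda>x y. x - y \<in> two_sided_ideal glq_relators)"
    by (rule sympI) (use two_sided_ideal_uminus in fastforce)
  show "transp (\<lambda>x y. x - y \<in> two_sided_ideal glq_relators)"
    by (rule transpI) (use two_sided_ideal.add in fastforce)
qed

lift_definition pm_filter :: "('k \<Rightarrow> bool) \<Rightarrow> ('k \<Rightarrow>\<^sub>0 'b::zero) \<Rightarrow> ('k \<Rightarrow>\<^sub>0 'b)"
  is "\<lambda>P x k. if P k then x k else 0"
  by (rule finite_subset) auto

definition fpart :: "bit \<Rightarrow> ('m::finite, 'n::finite) gl_free \<Rightarrow> ('m, 'n) gl_free"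
  where "fpart d = pm_filter (\<lambda>w. word_parity w = d)"

lemma lookup_fpart:
  "Poly_Mapping.lookup (fpart d x) w = (if word_parity w = d then Poly_Mapping.lookup x w else 0)"
  by (simp add: fpart_def pm_filter.rep_eq)

lemma fpart_add: "fpart d (x + y) = fpart d x + fpart d y"
  by (rule poly_mapping_eqI) (simp add: lookup_fpart lookup_add)

lemma fpart_zero [simp]: "fpart d 0 = 0"
  by (rule poly_mapping_eqI) (simp add: lookup_fpart)

lemma fpart_diff: "fpart d (x - y) = fpart d x - fpart d y"
  by (rule poly_mapping_eqI) (simp add: lookup_fpart lookup_minus)

lemma fpart_single:
  "fpart d (Poly_Mapping.single w c) = (if word_parity w = d then Poly_Mapping.single w c else 0)"
  by (rule poly_mapping_eqI) (auto simp: lookup_fpart lookup_single when_def)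

lemma fpart_decomp: "fpart 0 x + fpart 1 x = x"
  by (rule poly_mapping_eqI) (auto simp: lookup_fpart lookup_add)

lemma fpart_fpart: "fpart d (fpart e x) = (if d = e then fpart e x else 0)"
  by (rule poly_mapping_eqI) (auto simp: lookup_fpart)

lemma word_parity_add: "word_parity (v + w) = word_parity v + word_parity w"
  by (simp add: word_parity_def plus_list_def)

lemma fpart_mult: "fpart d (x * y) = fpart 0 x * fpart d y + fpart 1 x * fpart (d + 1) y"
proof (induction x rule: poly_mapping_single_induct)
  case 1: (add v c x)
  have "fpart d (Poly_Mapping.single v c * y)
      = fpart 0 (Poly_Mapping.single v c) * fpart d y
        + fpart 1 (Poly_Mapping.single v c) * fpart (d + 1) y"
  proof (induction y rule: poly_mapping_single_induct)
    case (add w b y)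
    then show ?case
      by (cases "word_parity v"; cases "word_parity w"; cases d)
        (simp_all add: distrib_left fpart_add mult_single fpart_single word_parity_add)
  qed simp
  then show ?case by (simp add: distrib_right fpart_add 1 add_ac)
qed simp

lemma fpart_fconst: "fpart d (fconst c) = (if d = 0 then fconst c else 0)"
  by (simp add: fconst_def fpart_single word_parity_def)

lemma fpart_one: "fpart d 1 = (if d = 0 then 1 else 0)"
proof -
  have "(1::('a, 'b) gl_free) = fconst 1"
    by (metis fconst_def single_one zero_list_def)
  thus ?thesis using fpart_fconst by metis
qed

definition fhom :: "bit \<Rightarrow> ('m::finite, 'n::finite) gl_free \<Rightarrow> bool"
  where "fhom d x \<longleftrightarrow> fpart d x = x"

lemma fhomD: "fhom d x \<Longrightarrow> fpart e x = (if e = d then x else 0)"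
  by (metis fhom_def fpart_fpart)

lemma fhom_fpart: "fhom d (fpart d x)"
  by (simp add: fhom_def fpart_fpart)

lemma fhom_mult: "fhom d x \<Longrightarrow> fhom e y \<Longrightarrow> fhom (d + e) (x * y)"
proof -
  assume a: "fhom d x" "fhom e y"
  show "fhom (d + e) (x * y)"
    unfolding fhom_def[of "d + e"] fpart_mult fhomD[OF a(1)] fhomD[OF a(2)]
    by (cases d; cases e) simp_all
qed

lemma fhom_mult': "fhom d x \<Longrightarrow> fhom e y \<Longrightarrow> f = d + e \<Longrightarrow> fhom f (x * y)"
  using fhom_mult by blast

lemma fhom_diff: "fhom d x \<Longrightarrow> fhom d y \<Longrightarrow> fhom d (x - y)"
  by (simp add: fhom_def fpart_diff)

lemma fhom_sum: "(\<And>i. i \<in> A \<Longrightarrow> fhom d (f i)) \<Longrightarrow> fhom d (sum f A)"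
  by (induction A rule: infinite_finite_induct) (auto simp: fhom_def fpart_add)

lemma fhom_const_mult: "fhom d x \<Longrightarrow> fhom d (fconst c * x)"
  by (cases d) (simp_all add: fhom_def fpart_mult fpart_fconst)

lemma fhom_one: "fhom 0 1"
  by (simp add: fhom_def fpart_one)

lemma fhom_fgen: "fhom (gen_parity g) (fgen g)"
  by (simp add: fhom_def fgen_def fpart_single word_parity_def)

lemma fhom_fa:
  assumes "i \<in> {1..CARD('m) + CARD('n)}" "j \<in> {1..CARD('m) + CARD('n)}"
  shows "fhom (a_parity CARD('m) i j) (fa i j :: ('m::finite, 'n::finite) gl_free)"
  using fhom_fgen[of "Gen_a (Abs_idx i) (Abs_idx j) :: ('m, 'n) gl_gen"] assms
  by (simp add: fa_def Abs_idx_inverse)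

lemma fhom_prod_list: "(\<And>x. x \<in> set xs \<Longrightarrow> fhom 0 x) \<Longrightarrow> fhom 0 (prod_list xs)"
  by (induction xs) (auto intro: fhom_one fhom_mult'[of 0 _ 0])

lemma fhom_fD1: "fhom 0 (fD1 :: ('m::finite, 'n::finite) gl_free)"
  unfolding fD1_def
proof (intro fhom_sum fhom_const_mult fhom_prod_list)
  fix \<sigma> and x :: "('m, 'n) gl_free"
  assume "\<sigma> \<in> {\<sigma>. \<sigma> permutes {1..CARD('m)}}"
    "x \<in> set (map (\<lambda>i. fa i (\<sigma> i)) [1..<Suc CARD('m)])"
  hence \<sigma>: "\<sigma> permutes {1..CARD('m)}" and "\<exists>i. i \<in> {1..CARD('m)} \<and> x = fa i (\<sigma> i)"
    by (auto simp del: upt_Suc)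
  then obtain i where "i \<in> {1..CARD('m)}" "x = fa i (\<sigma> i)"
    by blast
  moreover from this have "\<sigma> i \<in> {1..CARD('m)}" using permutes_in_image[OF \<sigma>] by blast
  ultimately have i: "i \<in> {1..CARD('m)}" "\<sigma> i \<in> {1..CARD('m)}" "x = fa i (\<sigma> i)"
    by blast+
  thus "fhom 0 x"
    using fhom_fa[of i "\<sigma> i", where 'm = 'm and 'n = 'n]
    by (simp add: a_parity_def idx_parity_def)
qed

lemma fhom_fD2: "fhom 0 (fD2 :: ('m::finite, 'n::finite) gl_free)"
  unfolding fD2_def
proof (intro fhom_sum fhom_const_mult fhom_prod_list)
  fix \<sigma> and x :: "('m, 'n) gl_free"
  assume "\<sigma> \<in> {\<sigma>. \<sigma> permutes {1..CARD('n)}}"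
    "x \<in> set (map (\<lambda>i. fa (CARD('m) + i) (CARD('m) + \<sigma> i)) [1..<Suc CARD('n)])"
  hence \<sigma>: "\<sigma> permutes {1..CARD('n)}" and "\<exists>i. i \<in> {1..CARD('n)} \<and> x = fa (CARD('m) + i) (CARD('m) + \<sigma> i)"
    by (auto simp del: upt_Suc)
  then obtain i where "i \<in> {1..CARD('n)}" "x = fa (CARD('m) + i) (CARD('m) + \<sigma> i)"
    by blast
  moreover from this have "\<sigma> i \<in> {1..CARD('n)}" using permutes_in_image[OF \<sigma>] by blast
  ultimately have i: "i \<in> {1..CARD('n)}" "\<sigma> i \<in> {1..CARD('n)}" "x = fa (CARD('m) + i) (CARD('m) + \<sigma> i)"
    by blast+
  thus "fhom 0 x"
    using fhom_fa[of "CARD('m) + i" "CARD('m) + \<sigma> i", where 'm = 'm and 'n = 'n]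
    by (simp add: a_parity_def idx_parity_def)
qed

lemma mq_relators_homogeneous:
  assumes "r \<in> (mq_relators :: ('m::finite, 'n::finite) gl_free set)"
  shows "\<exists>d. fhom d r"
proof -
  define I where "I = {1..CARD('m) + CARD('n)}"
  define P where "P = a_parity CARD('m)"
  have a: "fhom (P i j) (fa i j :: ('m, 'n) gl_free)" if "i \<in> I" "j \<in> I" for i j
    using fhom_fa that by (auto simp: I_def P_def)
  have aa: "fhom (P i j + P k l) (fa i j * fa k l :: ('m, 'n) gl_free)"
    "fhom (P i j + P k l) (fa k l * fa i j :: ('m, 'n) gl_free)"
    if "i \<in> I" "j \<in> I" "k \<in> I" "l \<in> I" for i j k l
    using fhom_mult[OF a[OF that(1,2)] a[OF that(3,4)]]
      fhom_mult'[OF a[OF that(3,4)] a[OF that(1,2)] add.commute] by this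
  have P: "P k j + P i l = P i j + P k l" for i j k l
    by (simp only: P_def a_parity_def add_ac)
  have aa': "fhom (P i j + P k l) (fa k j * fa i l :: ('m, 'n) gl_free)"
    if "i \<in> I" "j \<in> I" "k \<in> I" "l \<in> I" for i j k l
    using aa(1)[of k j i l] that P[of k j i l] by simp
  note intros = aa aa' fhom_diff fhom_const_mult
  show ?thesis
    using assms unfolding mq_relators_def Let_def I_def[symmetric] mult.assoc
    by (elim UnE CollectE exE conjE; (hypsubst, blast intro: intros))
qed

lemma glq_relators_homogeneous:
  assumes "r \<in> (glq_relators :: ('m::finite, 'n::finite) gl_free set)"
  shows "\<exists>d. fhom d r"
proof (cases "r \<in> mq_relators")
  case False
  have "fhom 0 (fgen Gen_D1inv :: ('m, 'n) gl_free)" "fhom 0 (fgen Gen_D2inv :: ('m, 'n) gl_free)"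
    using fhom_fgen[of "Gen_D1inv :: ('m, 'n) gl_gen"] fhom_fgen[of "Gen_D2inv :: ('m, 'n) gl_gen"]
    by simp_all
  hence "fhom 0 r"
    using assms False unfolding glq_relators_def
    by (auto intro!: fhom_diff fhom_one fhom_fD1 fhom_fD2 fhom_mult'[of 0 _ 0])
  thus ?thesis ..
qed (rule mq_relators_homogeneous)

lemma fpart_ideal:
  assumes "x \<in> two_sided_ideal glq_relators"
  shows "fpart d x \<in> two_sided_ideal glq_relators"
  using assms
proof (induction arbitrary: d)
  case (base r)
  then obtain e where "fhom e r" using glq_relators_homogeneous by blast
  then show ?case using base by (simp add: fhomD two_sided_ideal.intros)
qed (auto simp: fpart_add fpart_mult intro: two_sided_ideal.intros)

lemma fconst_simps:
  "fconst (c + d) = fconst c + fconst d" "fconst (c * d) = fconst c * fconst d" "fconst 1 = 1"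
  by (simp_all add: fconst_def single_add mult_single plus_list_def)
    (metis single_one zero_list_def)

lemma fconst_commute: "x * fconst c = fconst c * x"
  by (induction x rule: poly_mapping_single_induct)
    (simp_all add: distrib_left distrib_right fconst_def mult_single plus_list_def mult.commute)

instantiation glq :: (finite, finite) cq_superalgebra
begin

lift_definition zero_glq :: "('a, 'b) glq" is 0 .

lift_definition one_glq :: "('a, 'b) glq" is 1 .

lift_definition plus_glq :: "('a, 'b) glq \<Rightarrow> ('a, 'b) glq \<Rightarrow> ('a, 'b) glq"
  is "(+)" by (metis add_diff_add two_sided_ideal.add)

lift_definition minus_glq :: "('a, 'b) glq \<Rightarrow> ('a, 'b) glq \<Rightarrow> ('a, 'b) glq"
  is "(-)"
proof -
  fix a b c d :: "('a, 'b) gl_free"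
  assume "a - b \<in> two_sided_ideal glq_relators" "c - d \<in> two_sided_ideal glq_relators"
  hence "(a - b) - (c - d) \<in> two_sided_ideal glq_relators" by (rule two_sided_ideal_diff)
  thus "a - c - (b - d) \<in> two_sided_ideal glq_relators" by (simp add: algebra_simps)
qed

lift_definition uminus_glq :: "('a, 'b) glq \<Rightarrow> ('a, 'b) glq" is uminus
proof -
  fix a b :: "('a, 'b) gl_free"
  assume "a - b \<in> two_sided_ideal glq_relators"
  hence "- (a - b) \<in> two_sided_ideal glq_relators" by (rule two_sided_ideal_uminus)
  thus "- a - - b \<in> two_sided_ideal glq_relators" by (simp add: algebra_simps)
qed

lift_definition times_glq :: "('a, 'b) glq \<Rightarrow> ('a, 'b) glq \<Rightarrow> ('a, 'b) glq" is "(*)"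
proof -
  fix a b c d :: "('a, 'b) gl_free"
  assume "a - b \<in> two_sided_ideal glq_relators" "c - d \<in> two_sided_ideal glq_relators"
  hence "(a - b) * c + b * (c - d) \<in> two_sided_ideal glq_relators"
    by (intro two_sided_ideal.add two_sided_ideal.left two_sided_ideal.right)
  thus "a * c - b * d \<in> two_sided_ideal glq_relators" by (simp add: algebra_simps)
qed

lift_definition cq_scale_glq :: "laurent \<Rightarrow> ('a, 'b) glq \<Rightarrow> ('a, 'b) glq"
  is "\<lambda>c x. fconst c * x" by (metis right_diff_distrib two_sided_ideal.left)

lift_definition spart_glq :: "bit \<Rightarrow> ('a, 'b) glq \<Rightarrow> ('a, 'b) glq"
  is fpart by (metis fpart_diff fpart_ideal)

instance
proof
  fix x y z :: "('a, 'b) glq" and c d :: laurent and i j :: bit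
  have eqI: "u = v \<Longrightarrow> u - v \<in> two_sided_ideal glq_relators" for u v :: "('a, 'b) gl_free"
    by (simp add: two_sided_ideal.zero)
  show "x + y + z = x + (y + z)" by transfer (rule eqI, simp add: add_ac)
  show "x + y = y + x" by transfer (rule eqI, simp add: add_ac)
  show "0 + x = x" by transfer (rule eqI, simp)
  show "- x + x = 0" by transfer (rule eqI, simp)
  show "x - y = x + - y" by transfer (rule eqI, simp)
  show "x * y * z = x * (y * z)" by transfer (rule eqI, simp add: mult.assoc)
  show "1 * x = x" by transfer (rule eqI, simp)
  show "x * 1 = x" by transfer (rule eqI, simp)
  show "(x + y) * z = x * z + y * z" by transfer (rule eqI, simp add: distrib_right)
  show "x * (y + z) = x * y + x * z" by transfer (rule eqI, simp add: distrib_left)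
  show "c *\<^sub>q (x + y) = c *\<^sub>q x + c *\<^sub>q y" by transfer (rule eqI, simp add: distrib_left)
  show "(c + d) *\<^sub>q x = c *\<^sub>q x + d *\<^sub>q x"
    by transfer (rule eqI, simp add: distrib_right fconst_simps)
  show "c *\<^sub>q (d *\<^sub>q x) = (c * d) *\<^sub>q x"
    by transfer (rule eqI, simp add: mult.assoc fconst_simps)
  show "1 *\<^sub>q x = x" by transfer (rule eqI, simp add: fconst_simps)
  show "(c *\<^sub>q x) * y = c *\<^sub>q (x * y)" by transfer (rule eqI, simp add: mult.assoc)
  show "x * (c *\<^sub>q y) = c *\<^sub>q (x * y)"
    by transfer (rule eqI, simp only: mult.assoc[symmetric] fconst_commute)
  show "spart i (x + y) = spart i x + spart i y" by transfer (rule eqI, simp add: fpart_add)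
  show "spart i (c *\<^sub>q x) = c *\<^sub>q spart i x"
    by transfer (rule eqI, simp add: fpart_mult fpart_fconst)
  show "spart 0 x + spart 1 x = x" by transfer (rule eqI, simp add: fpart_decomp)
  show "spart i (spart j x) = (if i = j then spart j x else 0)"
    by (cases "i = j"; simp; transfer; rule eqI; simp add: fpart_fpart)
  show "spart (i + j) (spart i x * spart j y) = spart i x * spart j y"
    by transfer (rule eqI, rule fhom_mult[OF fhom_fpart fhom_fpart, unfolded fhom_def])
  show "spart 0 (1::('a, 'b) glq) = 1" by transfer (rule eqI, simp add: fpart_one)
qed

end

lift_definition glq_a :: "nat \<Rightarrow> nat \<Rightarrow> ('m::finite, 'n::finite) glq" is fa .

section \<open>Comultiplication, counit and coactions\<close>

text \<open>A superalgebra morphism on \<open>GL\<^sub>q(m|n)\<close> is determined by its values on the \<open>a\<^sub>i\<^sub>j\<close>, because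
  the remaining generators are inverses of polynomials in these. So there is at most one map with
  each of the following properties.\<close>

definition glq_comultiplication ::
    "(('m::finite, 'n::finite) glq \<Rightarrow> (('m, 'n) glq, ('m, 'n) glq) tensor) \<Rightarrow> bool" where
  "glq_comultiplication \<Delta> \<longleftrightarrow> superalgebra_hom \<Delta> \<and>
     (\<forall>i\<in>{1..CARD('m) + CARD('n)}. \<forall>j\<in>{1..CARD('m) + CARD('n)}.
        \<Delta> (glq_a i j) = (\<Sum>k = 1..CARD('m) + CARD('n). glq_a i k \<otimes>\<^sub>q glq_a k j))"

text \<open>The ground ring is purely even, so the counit vanishes on odd elements.\<close>

definition glq_counit :: "(('m::finite, 'n::finite) glq \<Rightarrow> laurent) \<Rightarrow> bool" where
  "glq_counit \<epsilon> \<longleftrightarrow>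
     (\<forall>x y. \<epsilon> (x + y) = \<epsilon> x + \<epsilon> y) \<and> (\<forall>c x. \<epsilon> (c *\<^sub>q x) = c * \<epsilon> x) \<and>
     (\<forall>x y. \<epsilon> (x * y) = \<epsilon> x * \<epsilon> y) \<and> \<epsilon> 1 = 1 \<and> (\<forall>x. \<epsilon> (spart 1 x) = 0) \<and>
     (\<forall>i\<in>{1..CARD('m) + CARD('n)}. \<forall>j\<in>{1..CARD('m) + CARD('n)}.
        \<epsilon> (glq_a i j) = (if i = j then 1 else 0))"

text \<open>The map \<open>\<rho>\<close>, a linear map on an ambient superalgebra, restricts to a left coaction
  \<open>V \<rightarrow> H \<otimes> V\<close> of the bialgebra \<open>(H, \<Delta>, \<epsilon>)\<close> on the subalgebra \<open>V\<close>: an even algebra morphism which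
  is coassociative and counital. Here \<open>H \<otimes> V\<close> is the submodule \<^const>\<open>tensor_sub\<close> of the tensor
  product of \<open>H\<close> with the ambient algebra.\<close>

definition restricts_to_left_coaction ::
    "('h::cq_superalgebra \<Rightarrow> ('h, 'h) tensor) \<Rightarrow> ('h \<Rightarrow> laurent) \<Rightarrow> 'a::cq_superalgebra set \<Rightarrow>
     ('a \<Rightarrow> ('h, 'a) tensor) \<Rightarrow> bool" where
  "restricts_to_left_coaction \<Delta> \<epsilon> V \<rho> \<longleftrightarrow>
     (\<forall>x\<in>V. \<rho> x \<in> tensor_sub UNIV V) \<and>
     superalgebra_hom_on V \<rho> \<and>
     (\<forall>x\<in>V. tassoc (tmap \<Delta> id (\<rho> x)) = tmap id \<rho> (\<rho> x)) \<and>
     (\<forall>x\<in>V. tlift (\<lambda>h a. \<epsilon> h *\<^sub>q a) (\<rho> x) = x)"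

section \<open>The quantum super Grassmannian of 2|0 planes in 4|1 superspace\<close>

definition Gr_D :: "nat \<Rightarrow> nat \<Rightarrow> (4, 1) glq" where
  "Gr_D i j = glq_a i 1 * glq_a j 2 - qpow (- 1) *\<^sub>q (glq_a i 2 * glq_a j 1)"

definition Gr_q :: "(4, 1) glq set" where
  "Gr_q = cq_subalgebra ({Gr_D i j |i j. 1 \<le> i \<and> i < j \<and> j \<le> 4} \<union>
     {Gr_D i 5 |i. 1 \<le> i \<and> i \<le> 4} \<union> {glq_a 5 1 * glq_a 5 2})"

end

theory Submission
  imports Defs
begin

text \<open>Put \<open>D k l = a\<^sub>k\<^sub>1 a\<^sub>l\<^sub>2 - q\<^sup>-\<^sup>1 a\<^sub>k\<^sub>2 a\<^sub>l\<^sub>1\<close> for all \<open>k\<close> and \<open>l\<close>. Since \<open>a\<^sub>k\<^sub>1\<close> and \<open>a\<^sub>k\<^sub>2\<close> have the same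
  parity, \<open>\<Delta> (D i j)\<close> is the sum of the terms \<open>\<plusminus> a\<^sub>i\<^sub>k a\<^sub>j\<^sub>l \<otimes> D k l\<close>, and the commutation relations
  express every \<open>D k l\<close> as a multiple of a generator of the Grassmannian. Coassociativity and
  counitality are equalities between algebra morphisms, so they need to be checked only on the
  \<open>a\<^sub>i\<^sub>j\<close>.\<close>

section \<open>Algebra morphisms on tensor products\<close>

text \<open>Agreement on generators propagates through sums, scalars, products and the unit, so this
  ungraded notion is enough to compare morphisms; it spares tracking the parity of
  \<open>tassoc\<close> and of the counit contraction.\<close>

definition cq_algebra_hom :: "('a::cq_algebra \<Rightarrow> 'b::cq_algebra) \<Rightarrow> bool" where
  "cq_algebra_hom f \<longleftrightarrow> cq_linear f \<and> (\<forall>x y. f (x * y) = f x * f y) \<and> f 1 = 1"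

lemma cq_linearD:
  assumes "cq_linear f"
  shows "f (x + y) = f x + f y" "f (c *\<^sub>q x) = c *\<^sub>q f x"
  using assms by (simp_all add: cq_linear_def)

lemma cq_linear_zero: "cq_linear f \<Longrightarrow> f 0 = 0"
  using cq_linearD(2)[of f 0 0] by simp

lemma cq_linear_diff: "cq_linear f \<Longrightarrow> f (x - y) = f x - f y"
  using cq_linearD(1)[of f "x - y" y] by (simp add: algebra_simps)

lemma cq_linear_sum: "cq_linear f \<Longrightarrow> f (\<Sum>i\<in>A. g i) = (\<Sum>i\<in>A. f (g i))"
  by (induction A rule: infinite_finite_induct) (simp_all add: cq_linear_zero cq_linearD)

lemma cq_linear_comp: "cq_linear f \<Longrightarrow> cq_linear g \<Longrightarrow> cq_linear (\<lambda>x. f (g x))"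
  by (simp add: cq_linear_def)

lemma cq_algebra_homD:
  assumes "cq_algebra_hom f"
  shows "cq_linear f" "f (x * y) = f x * f y" "f 1 = 1"
  using assms by (simp_all add: cq_algebra_hom_def)

lemma cq_algebra_hom_comp:
  "cq_algebra_hom f \<Longrightarrow> cq_algebra_hom g \<Longrightarrow> cq_algebra_hom (\<lambda>x. f (g x))"
  by (simp add: cq_algebra_hom_def cq_linear_def)

lemma cq_algebra_hom_id: "cq_algebra_hom (\<lambda>x. x)" "cq_algebra_hom id"
  by (simp_all add: cq_algebra_hom_def cq_linear_def)

lemma superalgebra_homD:
  assumes "superalgebra_hom f"
  shows "cq_algebra_hom f" "f (spart d x) = spart d (f x)"
  using assms by (simp_all add: superalgebra_hom_on_def cq_algebra_hom_def cq_linear_def)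

lemma superalgebra_hom_id: "superalgebra_hom id"
  by (simp add: superalgebra_hom_on_def)

lemma cq_algebra_hom_eq_on_subalgebra:
  assumes "x \<in> cq_subalgebra S" "cq_algebra_hom f" "cq_algebra_hom g" "\<And>x. x \<in> S \<Longrightarrow> f x = g x"
  shows "f x = g x"
  using assms(1) by induction
    (simp_all add: assms(4) cq_algebra_homD(2,3)[OF assms(2)] cq_algebra_homD(2,3)[OF assms(3)]
      cq_linearD[OF cq_algebra_homD(1)[OF assms(2)]] cq_linearD[OF cq_algebra_homD(1)[OF assms(3)]])

lemma cq_linear_tlift: "cq_bilinear f \<Longrightarrow> cq_linear (tlift f)"
  by (simp add: cq_linear_def tlift_add tlift_scale)

text \<open>Homogeneous pure tensors span, and the product of two of them is one pure tensor with
  the sign \<open>ksign e d'\<close>, so bilinearity reduces multiplicativity to an identity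
  carrying this sign.\<close>

lemma cq_algebra_hom_tensorI:
  fixes f :: "('a::cq_superalgebra, 'b::cq_superalgebra) tensor \<Rightarrow> 'c::cq_algebra"
  assumes "cq_linear f" "f (1 \<otimes>\<^sub>q 1) = 1"
    and mult: "\<And>a b d e a' b' d' e'. spart d a = a \<Longrightarrow> spart e b = b \<Longrightarrow>
      spart d' a' = a' \<Longrightarrow> spart e' b' = b' \<Longrightarrow>
      ksign e d' *\<^sub>q f ((a * a') \<otimes>\<^sub>q (b * b')) = f (a \<otimes>\<^sub>q b) * f (a' \<otimes>\<^sub>q b')"
  shows "cq_algebra_hom f"
proof -
  note lin = cq_linearD[OF assms(1)] cq_linear_zero[OF assms(1)]
  have "f (s * t) = f s * f t" for s t
  proof (induction s rule: tensor_induct_homogeneous)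
    case 1: (pure a b d e)
    show ?case
    proof (induction t rule: tensor_induct_homogeneous)
      case 2: (pure a' b' d' e')
      show ?case
        by (simp add: times_tensor_pure[OF 1(2) 2(1)] lin mult[OF 1 2])
    qed (simp_all add: lin distrib_left)
  qed (simp_all add: lin distrib_right)
  with assms(1,2) show ?thesis
    by (simp add: cq_algebra_hom_def one_tensor_def)
qed

lemma cq_linear_spart: "cq_linear (spart d)"
  by (simp add: cq_linear_def spart_add spart_scale)

lemma cq_linear_tensor: "cq_linear (\<lambda>t. t \<otimes>\<^sub>q c)" "cq_linear (\<lambda>t. c \<otimes>\<^sub>q t)"
  by (simp_all add: cq_linear_def tensor_bilinear)

lemma tensor_diff_right: "x \<otimes>\<^sub>q (y - z) = x \<otimes>\<^sub>q y - x \<otimes>\<^sub>q z"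
  by (rule cq_linear_diff[OF cq_linear_tensor(2)])

lemma spart_tensor_pure:
  assumes "spart d a = a" "spart e b = b"
  shows "spart (d + e) (a \<otimes>\<^sub>q b) = a \<otimes>\<^sub>q b"
  unfolding spart_tensor_def tlift_pure[OF spart_pure_bilinear] spart_pure_def
  by (cases d; cases e) (simp_all add: spart_homogeneous[OF assms(1)] spart_homogeneous[OF assms(2)])

lemma tmap_bilinear:
  "cq_linear f \<Longrightarrow> cq_linear g \<Longrightarrow> cq_bilinear (\<lambda>a b. f a \<otimes>\<^sub>q g b)"
  by (simp add: cq_bilinear_def cq_linear_def tensor_bilinear)

lemma tmap_pure: "cq_linear f \<Longrightarrow> cq_linear g \<Longrightarrow> tmap f g (a \<otimes>\<^sub>q b) = f a \<otimes>\<^sub>q g b"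
  by (simp add: tmap_def tlift_pure[OF tmap_bilinear])

lemma cq_linear_tmap: "cq_linear f \<Longrightarrow> cq_linear g \<Longrightarrow> cq_linear (tmap f g)"
  by (simp add: tmap_def cq_linear_tlift tmap_bilinear)

text \<open>Preservation of parity enters here: \<open>g b\<close> and \<open>f a'\<close> keep the
  degrees of \<open>b\<close> and \<open>a'\<close>, so the same sign governs the product before and
  after the map.\<close>

lemma cq_algebra_hom_tmap:
  fixes f :: "'a::cq_superalgebra \<Rightarrow> 'c::cq_superalgebra"
    and g :: "'b::cq_superalgebra \<Rightarrow> 'd::cq_superalgebra"
  assumes "superalgebra_hom f" "superalgebra_hom g"
  shows "cq_algebra_hom (tmap f g)"
proof -
  note f = cq_algebra_homD[OF superalgebra_homD(1)[OF assms(1)]]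
  note g = cq_algebra_homD[OF superalgebra_homD(1)[OF assms(2)]]
  show ?thesis
  proof (rule cq_algebra_hom_tensorI)
    fix a a' :: 'a and b b' :: 'b and e d'
    assume "spart e b = b" "spart d' a' = a'"
    then have "spart e (g b) = g b" "spart d' (f a') = f a'"
      by (simp_all add: superalgebra_homD(2)[OF assms(1), symmetric]
          superalgebra_homD(2)[OF assms(2), symmetric])
    then show "ksign e d' *\<^sub>q tmap f g ((a * a') \<otimes>\<^sub>q (b * b'))
        = tmap f g (a \<otimes>\<^sub>q b) * tmap f g (a' \<otimes>\<^sub>q b')"
      by (simp add: tmap_pure f g times_tensor_pure)
  qed (simp_all add: f g cq_linear_tmap tmap_pure one_tensor_def)
qed

lemma tassoc_inner_bilinear: "cq_bilinear (\<lambda>a b. a \<otimes>\<^sub>q (b \<otimes>\<^sub>q c))"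
  by (simp add: cq_bilinear_def cq_linear_def tensor_bilinear)

lemma tassoc_bilinear: "cq_bilinear (\<lambda>t c. tlift (\<lambda>a b. a \<otimes>\<^sub>q (b \<otimes>\<^sub>q c)) t)"
  unfolding cq_bilinear_def cq_linear_def
  by (intro conjI allI; rule tlift_param_add tlift_param_scale tlift_add tlift_scale;
      (rule tassoc_inner_bilinear | simp add: tensor_bilinear))

lemma tassoc_pure: "tassoc ((a \<otimes>\<^sub>q b) \<otimes>\<^sub>q c) = a \<otimes>\<^sub>q (b \<otimes>\<^sub>q c)"
  by (simp add: tassoc_def tlift_pure[OF tassoc_bilinear] tlift_pure[OF tassoc_inner_bilinear])

lemma cq_linear_tassoc: "cq_linear tassoc"
  by (simp add: tassoc_def cq_linear_tlift tassoc_bilinear)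


text \<open>Both bracketings produce the same sign: moving \<open>a \<otimes> b\<close> past
  \<open>c\<close> and then \<open>a\<close> past \<open>y\<close> costs as much as moving
  \<open>a\<close> past \<open>y \<otimes> c\<close> and \<open>b\<close> past
  \<open>c\<close>.\<close>

lemma cq_algebra_hom_tassoc:
  "cq_algebra_hom (tassoc :: (('a::cq_superalgebra, 'b::cq_superalgebra) tensor,
     'c::cq_superalgebra) tensor \<Rightarrow> _)"
proof (rule cq_algebra_hom_tensorI)
  fix s t :: "('a, 'b) tensor" and c c' :: 'c and d e d' e'
  assume c: "spart e c = c" and t: "spart d' t = t"
  have lin: "cq_linear (\<lambda>t. tassoc (t \<otimes>\<^sub>q c))" for c :: 'c
    by (rule cq_linear_comp[OF cq_linear_tassoc cq_linear_tensor(1)])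
  note lin_simps = cq_linearD[OF lin] cq_linear_zero[OF lin]
  \<comment> \<open>First the right factor is a pure tensor with homogeneous components, whose
    degree is \<open>i + j\<close>.\<close>
  have *: "ksign e d' *\<^sub>q tassoc ((s * (a \<otimes>\<^sub>q b)) \<otimes>\<^sub>q (c * c'))
      = tassoc (s \<otimes>\<^sub>q c) * tassoc ((a \<otimes>\<^sub>q b) \<otimes>\<^sub>q c')"
    if ab: "spart i a = a" "spart j b = b" and d': "d' = i + j" for a b i j
  proof (induction s rule: tensor_induct_homogeneous)
    case (pure x y k l)
    have bc: "spart (l + e) (y \<otimes>\<^sub>q c) = y \<otimes>\<^sub>q c"
      by (rule spart_tensor_pure[OF pure(2) c])
    have "ksign e d' *\<^sub>q tassoc (((x \<otimes>\<^sub>q y) * (a \<otimes>\<^sub>q b)) \<otimes>\<^sub>q (c * c'))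
        = (ksign e d' * ksign l i) *\<^sub>q ((x * a) \<otimes>\<^sub>q ((y * b) \<otimes>\<^sub>q (c * c')))"
      by (simp only: times_tensor_pure[OF pure(2) ab(1)] lin_simps tassoc_pure cq_scale_scale)
    \<comment> \<open>In exponents modulo 2 this is e(i + j) + l i = (l + e) i + e j.\<close>
    also have "ksign e d' * ksign l i = ksign (l + e) i * ksign e j"
      unfolding d' by (cases e; cases l; cases i; cases j) (simp_all add: ksign_def)
    also have "(ksign (l + e) i * ksign e j) *\<^sub>q ((x * a) \<otimes>\<^sub>q ((y * b) \<otimes>\<^sub>q (c * c')))
        = tassoc ((x \<otimes>\<^sub>q y) \<otimes>\<^sub>q c) * tassoc ((a \<otimes>\<^sub>q b) \<otimes>\<^sub>q c')"
      by (simp only: tassoc_pure times_tensor_pure[OF bc ab(1)] times_tensor_pure[OF c ab(2)]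
          tensor_bilinear cq_scale_scale)
    finally show ?case .
  qed (simp_all only: lin_simps distrib_right cq_scale_right_distrib mult_zero_left cq_scale_zero_right)
  \<comment> \<open>A homogeneous \<open>t\<close> may be written with pure summands of other
    degrees, so the induction runs over an arbitrary \<open>u\<close> and its component
    \<open>spart d' u\<close>; summands of the wrong degree project to zero.\<close>
  have **: "ksign e d' *\<^sub>q tassoc ((s * spart d' u) \<otimes>\<^sub>q (c * c'))
      = tassoc (s \<otimes>\<^sub>q c) * tassoc (spart d' u \<otimes>\<^sub>q c')" for u
  proof (induction u rule: tensor_induct_homogeneous)
    case zero
    show ?case
      by (simp add: cq_linear_zero[OF cq_linear_spart] cq_linear_zero[OF cq_linear_tassoc])
  next
    case (pure a b i j)
    show ?case
    proof (cases "d' = i + j")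
      case True
      then have "spart d' (a \<otimes>\<^sub>q b) = a \<otimes>\<^sub>q b"
        using spart_tensor_pure[OF pure] by simp
      then show ?thesis
        using *[OF pure True] by simp
    next
      case False
      then have "spart d' (a \<otimes>\<^sub>q b) = 0"
        by (simp only: spart_homogeneous[OF spart_tensor_pure[OF pure]] if_False)
      then show ?thesis
        by (simp add: cq_linear_zero[OF cq_linear_tassoc])
    qed
  next
    case (add u v)
    then show ?case
      by (simp add: spart_add lin_simps distrib_left cq_scale_right_distrib)
  qed
  show "ksign e d' *\<^sub>q tassoc ((s * t) \<otimes>\<^sub>q (c * c')) = tassoc (s \<otimes>\<^sub>q c) * tassoc (t \<otimes>\<^sub>q c')"
    using **[of t] t by simp
qed (simp_all add: cq_linear_tassoc one_tensor_def tassoc_pure)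

section \<open>Submodules and subalgebras\<close>

lemma cq_subalgebra_zero: "0 \<in> cq_subalgebra S"
  using cq_subalgebra.scale[OF cq_subalgebra.one, of 0] by simp

lemma cq_subalgebra_diff:
  "x \<in> cq_subalgebra S \<Longrightarrow> y \<in> cq_subalgebra S \<Longrightarrow> x - y \<in> cq_subalgebra S"
  using cq_subalgebra.add[of x S "(- 1) *\<^sub>q y"] cq_subalgebra.scale[of y S "- 1"]
  by (simp add: cq_scale_minus_one)

lemma cq_subalgebra_least: "x \<in> cq_subalgebra S \<Longrightarrow> S \<subseteq> cq_subalgebra T \<Longrightarrow> x \<in> cq_subalgebra T"
  by (induction rule: cq_subalgebra.induct) (auto intro: cq_subalgebra.intros)

text \<open>Homogeneous generators make the generated subalgebra graded. This is wanted because the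
  sign rule for tensors splits factors into their parity components, which have to stay in the
  subalgebra.\<close>

lemma spart_subalgebra:
  fixes x :: "'a::cq_superalgebra"
  assumes "x \<in> cq_subalgebra S" "\<And>x. x \<in> S \<Longrightarrow> \<exists>d. spart d x = x"
  shows "spart d x \<in> cq_subalgebra S"
proof -
  note zero = cq_subalgebra_zero[of S]
  have one: "spart d (1::'a) \<in> cq_subalgebra S" for d
    using zero cq_subalgebra.one[of S] by (simp add: spart_homogeneous[OF spart_one])
  show ?thesis
    using assms(1)
  proof (induction arbitrary: d)
    case (base x)
    then obtain e where "spart e x = x" using assms(2) by blast
    then show ?case
      using spart_homogeneous[of e x d] base zero by (simp add: cq_subalgebra.base)
  next
    case (mult x y)
    let ?x = "\<lambda>e. spart e x" and ?y = "\<lambda>e. spart e y"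
    have hom: "spart d (?x i * ?y j) = (if d = i + j then ?x i * ?y j else 0)" for i j
      by (rule spart_homogeneous[OF spart_mult])
    have in_hom: "spart d (?x i * ?y j) \<in> cq_subalgebra S" for i j
      using mult.IH by (simp add: hom zero cq_subalgebra.mult)
    have "spart d (x * y) = spart d ((?x 0 + ?x 1) * (?y 0 + ?y 1))"
      by (simp only: spart_decomp)
    also have "\<dots> = spart d (?x 0 * ?y 0) + spart d (?x 1 * ?y 0)
        + (spart d (?x 0 * ?y 1) + spart d (?x 1 * ?y 1))"
      by (simp only: distrib_left distrib_right spart_add)
    finally show ?case
      using in_hom by (simp add: cq_subalgebra.add)
  qed (simp_all add: one spart_add spart_scale cq_subalgebra.add cq_subalgebra.scale)
qed

lemma cq_span_sum: "(\<And>i. i \<in> A \<Longrightarrow> f i \<in> cq_span S) \<Longrightarrow> sum f A \<in> cq_span S"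
  by (induction A rule: infinite_finite_induct) (auto intro: cq_span.intros)

text \<open>Meant for the coproduct of \<open>a_51 a_52\<close>, where off-diagonal terms are shown
  to lie in the span only after adding the term with the two indices exchanged.\<close>

lemma sum_square_in_span:
  fixes A :: "'i::linorder set"
  assumes "\<And>k. k \<in> A \<Longrightarrow> f k k \<in> cq_span S"
    and "\<And>k l. k \<in> A \<Longrightarrow> l \<in> A \<Longrightarrow> k < l \<Longrightarrow> f k l + f l k \<in> cq_span S"
  shows "(\<Sum>k\<in>A. \<Sum>l\<in>A. f k l) \<in> cq_span S"
  using assms
proof (induction A rule: infinite_finite_induct)
  case (insert x A)
  \<comment> \<open>The new element \<open>x\<close> may lie on either side of \<open>l\<close>, so
    the pair is used in whichever order is increasing.\<close>
  have "f x l + f l x \<in> cq_span S" if "l \<in> A" for l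
    using insert.prems(2)[of x l] insert.prems(2)[of l x] insert.hyps that
    by (cases x l rule: linorder_cases) (auto simp: add.commute)
  then have "(\<Sum>l\<in>A. f x l + f l x) \<in> cq_span S"
    by (rule cq_span_sum)
  \<comment> \<open>Enlarging the square by \<open>x\<close> adds a corner, and a row and a column
    that are matched entry by entry.\<close>
  then have "f x x + (\<Sum>l\<in>A. f x l + f l x) + (\<Sum>k\<in>A. \<Sum>l\<in>A. f k l) \<in> cq_span S"
    using insert by (intro cq_span.add) auto
  then show ?case
    using insert.hyps by (simp add: sum.distrib add_ac)
qed (auto intro: cq_span.intros)

lemma tensor_subI: "b \<in> B \<Longrightarrow> a \<otimes>\<^sub>q b \<in> tensor_sub UNIV B"
  unfolding tensor_sub_def by (rule cq_span.base) blast

text \<open>The second factors of a product of pure tensors have the form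
  \<open>spart d b * b'\<close>, and the subalgebra, being graded, contains them.\<close>

lemma tensor_sub_mult:
  assumes "s \<in> tensor_sub UNIV (cq_subalgebra S)" "t \<in> tensor_sub UNIV (cq_subalgebra S)"
    and hom: "\<And>x. x \<in> S \<Longrightarrow> \<exists>d. spart d x = x"
  shows "s * t \<in> tensor_sub UNIV (cq_subalgebra S)"
  using assms(1) unfolding tensor_sub_def
proof induction
  case (base s)
  then obtain a b where s: "s = a \<otimes>\<^sub>q b" "b \<in> cq_subalgebra S" by blast
  show ?case
    using assms(2) unfolding tensor_sub_def
  proof induction
    case (base t)
    then obtain a' b' where t: "t = a' \<otimes>\<^sub>q b'" "b' \<in> cq_subalgebra S" by blast
    have "s * t = tmul_pure a b a' b'"
      by (simp add: s t times_tensor_pure_left tlift_pure[OF times_tensor_inner_bilinear])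
    moreover have "ksign d e *\<^sub>q ((a * spart e a') \<otimes>\<^sub>q (spart d b * b'))
        \<in> tensor_sub UNIV (cq_subalgebra S)" for d e
      unfolding tensor_sub_def
      by (rule cq_span.scale, fold tensor_sub_def, rule tensor_subI, rule cq_subalgebra.mult,
          rule spart_subalgebra[OF s(2) hom], assumption, rule t(2))
    ultimately show ?case
      unfolding tmul_pure_def tensor_sub_def by (auto intro!: cq_span.add)
  qed (simp_all add: distrib_left cq_scale_mult_right cq_span.intros)
qed (simp_all add: distrib_right cq_scale_mult_left cq_span.intros)

text \<open>Closure of the target under products reduces the claim to generators.\<close>

lemma cq_algebra_hom_subalgebra_into_tensor_sub:
  assumes "x \<in> cq_subalgebra S" "cq_algebra_hom f"
    and hom: "\<And>x. x \<in> S \<Longrightarrow> \<exists>d. spart d x = x"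
    and gen: "\<And>x. x \<in> S \<Longrightarrow> f x \<in> tensor_sub UNIV (cq_subalgebra S)"
  shows "f x \<in> tensor_sub UNIV (cq_subalgebra S)"
  using assms(1)
proof induction
  case (base x)
  then show ?case by (rule gen)
next
  case one
  show ?case
    by (simp add: cq_algebra_homD(3)[OF assms(2)] one_tensor_def tensor_subI cq_subalgebra.one)
next
  case (mult x y)
  then show ?case
    by (simp add: cq_algebra_homD(2)[OF assms(2)] tensor_sub_mult hom)
qed (simp_all add: cq_linearD[OF cq_algebra_homD(1)[OF assms(2)]] tensor_sub_def cq_span.intros)

section \<open>Relations in the quantum general linear supergroup\<close>

lemma abs_glq_relator: "r \<in> mq_relators \<Longrightarrow> abs_glq r = 0"
  unfolding zero_glq_def glq.abs_eq_iff
  by (simp add: two_sided_ideal.base glq_relators_def)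

lemma abs_glq_simps:
  "abs_glq (x - y) = abs_glq x - abs_glq y"
  "abs_glq (x * y) = abs_glq x * abs_glq y"
  "abs_glq (fconst c) * z = c *\<^sub>q z"
  "abs_glq (fa i j) = glq_a i j"
  by (simp_all add: minus_glq.abs_eq times_glq.abs_eq glq_a.abs_eq)
    (induction z rule: glq.abs_induct, simp add: times_glq.abs_eq cq_scale_glq.abs_eq)

context
  fixes i j k l :: nat and I :: "nat set" and m :: nat
    and a :: "nat \<Rightarrow> nat \<Rightarrow> ('m::finite, 'n::finite) glq"
  defines "I \<equiv> {1..CARD('m) + CARD('n)}" and "m \<equiv> CARD('m)" and "a \<equiv> glq_a"
  assumes I: "i \<in> I" "j \<in> I"
begin

lemma glq_a_homogeneous: "spart (a_parity m i j) (a i j) = a i j"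
proof -
  have "fpart (a_parity m i j) (fa i j) = (fa i j :: ('m, 'n) gl_free)"
    using fhom_fa[of i j] I unfolding fhom_def I_def m_def by blast
  then show ?thesis
    unfolding a_def glq_a.abs_eq spart_glq.abs_eq by simp
qed

text \<open>As in the lemmas that follow, a relator has class zero in the quotient, and the
  vanishing difference is read as an equation.\<close>

lemma glq_a_row:
  assumes "l \<in> I" "j < l"
  shows "a i j * a i l = (ksign (a_parity m i j) (a_parity m i l)
    * qpow (if idx_parity m i = 0 then - 1 else 1)) *\<^sub>q (a i l * a i j)"
proof -
  have "fa i j * fa i l - fconst (ksign (a_parity m i j) (a_parity m i l)
      * qpow (if idx_parity m i = 0 then - 1 else 1)) * fa i l * fa i j
      \<in> (mq_relators :: ('m, 'n) gl_free set)"
    using I assms unfolding mq_relators_def Let_def I_def m_def by blast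
  from abs_glq_relator[OF this] show ?thesis
    by (simp only: abs_glq_simps a_def right_minus_eq cq_scale_mult_left)
qed

lemma glq_a_antidiagonal:
  assumes "k \<in> I" "l \<in> I" "i < k \<and> j > l \<or> i > k \<and> j < l"
  shows "a i j * a k l = ksign (a_parity m i j) (a_parity m k l) *\<^sub>q (a k l * a i j)"
proof -
  have "fa i j * fa k l - fconst (ksign (a_parity m i j) (a_parity m k l)) * fa k l * fa i j
      \<in> (mq_relators :: ('m, 'n) gl_free set)"
    using I assms unfolding mq_relators_def Let_def I_def m_def by blast
  from abs_glq_relator[OF this] show ?thesis
    by (simp only: abs_glq_simps a_def right_minus_eq cq_scale_mult_left)
qed

lemma glq_a_diagonal:
  assumes "k \<in> I" "l \<in> I" "i < k" "j < l"
  shows "a i j * a k l - ksign (a_parity m i j) (a_parity m k l) *\<^sub>q (a k l * a i j)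
    = (ksign (a_parity m i j) (a_parity m k j) * (qpow (- 1) - qpow 1)) *\<^sub>q (a k j * a i l)"
proof -
  have "fa i j * fa k l - fconst (ksign (a_parity m i j) (a_parity m k l)) * fa k l * fa i j
      - fconst (ksign (a_parity m i j) (a_parity m k j) * (qpow (- 1) - qpow 1)) * fa k j * fa i l
      \<in> (mq_relators :: ('m, 'n) gl_free set)"
    using I assms unfolding mq_relators_def Let_def I_def m_def by blast
  from abs_glq_relator[OF this] show ?thesis
    by (simp only: abs_glq_simps a_def right_minus_eq cq_scale_mult_left)
qed

lemma glq_a_odd_square:
  assumes "a_parity m i j = 1"
  shows "a i j * a i j = 0"
proof -
  have "fa i j * fa i j \<in> (mq_relators :: ('m, 'n) gl_free set)"
    using I assms unfolding mq_relators_def Let_def I_def m_def by blast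
  from abs_glq_relator[OF this] show ?thesis
    by (simp only: abs_glq_simps a_def)
qed

end

section \<open>Comultiplication and counit\<close>

lemma tlift_counit:
  fixes \<epsilon> :: "('m::finite, 'n::finite) glq \<Rightarrow> laurent"
  assumes "glq_counit \<epsilon>"
  shows "tlift (\<lambda>h a. \<epsilon> h *\<^sub>q a) (h \<otimes>\<^sub>q (b::'b::cq_superalgebra)) = \<epsilon> h *\<^sub>q b"
    and "cq_algebra_hom (tlift (\<lambda>h a. \<epsilon> h *\<^sub>q (a::'b)))"
proof -
  note \<epsilon> = assms[unfolded glq_counit_def]
  have bil: "cq_bilinear (\<lambda>h a. \<epsilon> h *\<^sub>q (a::'b))"
    using \<epsilon> by (simp add: cq_bilinear_def cq_linear_def cq_scale_right_distrib
        cq_scale_left_distrib cq_scale_scale mult.commute)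
  show pure: "tlift (\<lambda>h a. \<epsilon> h *\<^sub>q a) (h \<otimes>\<^sub>q b) = \<epsilon> h *\<^sub>q b" for h and b :: 'b
    by (rule tlift_pure[OF bil])
  show "cq_algebra_hom (tlift (\<lambda>h a. \<epsilon> h *\<^sub>q (a::'b)))"
  proof (rule cq_algebra_hom_tensorI)
    fix h h' :: "('m, 'n) glq" and b b' :: 'b and d' e
    assume "spart d' h' = h'"
    \<comment> \<open>the sign is harmless because the counit kills odd elements\<close>
    then have *: "ksign e d' * (\<epsilon> h * \<epsilon> h') = \<epsilon> h * \<epsilon> h'"
      using \<epsilon> by (cases d'; cases e) (simp_all add: ksign_def, metis)
    show "ksign e d' *\<^sub>q tlift (\<lambda>h a. \<epsilon> h *\<^sub>q a) ((h * h') \<otimes>\<^sub>q (b * b'))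
        = tlift (\<lambda>h a. \<epsilon> h *\<^sub>q a) (h \<otimes>\<^sub>q b) * tlift (\<lambda>h a. \<epsilon> h *\<^sub>q a) (h' \<otimes>\<^sub>q b')"
      using \<epsilon> by (simp add: pure cq_scale_scale cq_scale_mult_left cq_scale_mult_right * mult.commute[of "\<epsilon> h'"])
  qed (use \<epsilon> in \<open>simp_all add: cq_linear_tlift bil pure cq_scale_one\<close>)
qed

context
  fixes \<Delta> :: "('m::finite, 'n::finite) glq \<Rightarrow> (('m, 'n) glq, ('m, 'n) glq) tensor"
    and I :: "nat set" and M :: "('m, 'n) glq set"
  assumes comult: "glq_comultiplication \<Delta>"
  defines "I \<equiv> {1..CARD('m) + CARD('n)}"
    and "M \<equiv> cq_subalgebra {glq_a i j |i j. i \<in> I \<and> j \<in> I}"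
begin

lemma comult_superalgebra_hom: "superalgebra_hom \<Delta>"
  using comult by (simp add: glq_comultiplication_def)

lemma comult_hom: "cq_algebra_hom \<Delta>"
  by (rule superalgebra_homD(1)[OF comult_superalgebra_hom])

lemma comult_a: "i \<in> I \<Longrightarrow> j \<in> I \<Longrightarrow> \<Delta> (glq_a i j) = (\<Sum>k\<in>I. glq_a i k \<otimes>\<^sub>q glq_a k j)"
  using comult by (simp add: glq_comultiplication_def I_def)

text \<open>\<open>M\<close> is generated by the \<open>a_ij\<close>, the only generators on which
  the value of \<open>\<Delta>\<close> is prescribed; it contains the Grassmannian.\<close>

lemma comult_coassoc:
  assumes "x \<in> M"
  shows "tassoc (tmap \<Delta> id (\<Delta> x)) = tmap id \<Delta> (\<Delta> x)"
proof (rule cq_algebra_hom_eq_on_subalgebra[OF assms[unfolded M_def]])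
  note homs = comult_superalgebra_hom superalgebra_hom_id
  show "cq_algebra_hom (\<lambda>x. tassoc (tmap \<Delta> id (\<Delta> x)))"
    by (intro cq_algebra_hom_comp[OF cq_algebra_hom_tassoc]
        cq_algebra_hom_comp[OF cq_algebra_hom_tmap[OF homs] comult_hom])
  show "cq_algebra_hom (\<lambda>x. tmap id \<Delta> (\<Delta> x))"
    by (intro cq_algebra_hom_comp[OF cq_algebra_hom_tmap[OF homs(2,1)] comult_hom])
next
  fix x assume "x \<in> {glq_a i j :: ('m, 'n) glq |i j. i \<in> I \<and> j \<in> I}"
  then obtain i j where x: "x = glq_a i j" and ij: "i \<in> I" "j \<in> I" by blast
  note \<Delta> = cq_algebra_homD(1)[OF comult_hom]
  have id: "cq_linear (id :: ('m, 'n) glq \<Rightarrow> _)"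
    by (rule cq_algebra_homD(1)[OF cq_algebra_hom_id(2)])
  have "tassoc (tmap \<Delta> id (\<Delta> x)) = (\<Sum>k\<in>I. \<Sum>l\<in>I. glq_a i l \<otimes>\<^sub>q (glq_a l k \<otimes>\<^sub>q glq_a k j))"
    by (simp add: x ij comult_a cq_linear_sum[OF cq_linear_tmap[OF \<Delta> id]] tmap_pure[OF \<Delta> id]
        cq_linear_sum[OF cq_linear_tassoc] cq_linear_sum[OF cq_linear_tensor(1)] tassoc_pure)
  also have "\<dots> = tmap id \<Delta> (\<Delta> x)"
    \<comment> \<open>Applying \<open>\<Delta>\<close> to the right factor makes the first
      intermediate index the outer one, hence the exchange of sums.\<close>
    by (subst sum.swap) (simp add: x ij comult_a cq_linear_sum[OF cq_linear_tmap[OF id \<Delta>]]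
        tmap_pure[OF id \<Delta>] cq_linear_sum[OF cq_linear_tensor(2)])
  finally show "tassoc (tmap \<Delta> id (\<Delta> x)) = tmap id \<Delta> (\<Delta> x)" .
qed

lemma comult_counit:
  assumes "x \<in> M" "glq_counit \<epsilon>"
  shows "tlift (\<lambda>h a. \<epsilon> h *\<^sub>q a) (\<Delta> x) = x"
proof (rule cq_algebra_hom_eq_on_subalgebra[OF assms(1)[unfolded M_def]])
  note K = tlift_counit[OF assms(2), where 'b = "('m, 'n) glq"]
  show "cq_algebra_hom (\<lambda>x. tlift (\<lambda>h a. \<epsilon> h *\<^sub>q a) (\<Delta> x))"
    by (rule cq_algebra_hom_comp[OF K(2) comult_hom])
  show "cq_algebra_hom (\<lambda>x::('m, 'n) glq. x)"
    by (rule cq_algebra_hom_id)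
  fix x assume "x \<in> {glq_a i j :: ('m, 'n) glq |i j. i \<in> I \<and> j \<in> I}"
  then obtain i j where x: "x = glq_a i j" and ij: "i \<in> I" "j \<in> I" by blast
  have \<epsilon>: "\<epsilon> (glq_a i k) = (if k = i then 1 else 0)" if "k \<in> I" for k
    using assms(2) ij that by (auto simp: glq_counit_def I_def)
  have "tlift (\<lambda>h a. \<epsilon> h *\<^sub>q a) (\<Delta> x) = (\<Sum>k\<in>I. \<epsilon> (glq_a i k) *\<^sub>q glq_a k j)"
    by (simp add: x ij comult_a cq_linear_sum[OF cq_algebra_homD(1)[OF K(2)]] K(1))
  also have "\<dots> = (\<Sum>k\<in>I. if k = i then glq_a k j else 0)"
    by (rule sum.cong) (simp_all add: \<epsilon> cq_scale_one)
  also have "\<dots> = x"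
    using ij by (simp add: x I_def)
  finally show "tlift (\<lambda>h a. \<epsilon> h *\<^sub>q a) (\<Delta> x) = x" .
qed

text \<open>The sign comes from moving \<open>a_i'l\<close> past \<open>a_kj\<close> in the product
  of tensors.\<close>

lemma comult_a_mult_a:
  assumes "i \<in> I" "j \<in> I" "i' \<in> I" "j' \<in> I"
  shows "\<Delta> (glq_a i j * glq_a i' j') = (\<Sum>k\<in>I. \<Sum>l\<in>I.
    ksign (a_parity CARD('m) k j) (a_parity CARD('m) i' l) *\<^sub>q
      ((glq_a i k * glq_a i' l) \<otimes>\<^sub>q (glq_a k j * glq_a l j')))"
proof -
  have "\<Delta> (glq_a i j * glq_a i' j') = (\<Sum>k\<in>I. \<Sum>l\<in>I.
      (glq_a i k \<otimes>\<^sub>q glq_a k j) * (glq_a i' l \<otimes>\<^sub>q glq_a l j'))"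
    by (simp add: cq_algebra_homD(2)[OF comult_hom] comult_a assms sum_product)
  also have "\<dots> = (\<Sum>k\<in>I. \<Sum>l\<in>I.
      ksign (a_parity CARD('m) k j) (a_parity CARD('m) i' l) *\<^sub>q
        ((glq_a i k * glq_a i' l) \<otimes>\<^sub>q (glq_a k j * glq_a l j')))"
    using assms unfolding I_def
    by (intro sum.cong refl times_tensor_pure glq_a_homogeneous) simp_all
  finally show ?thesis .
qed

end

section \<open>The quantum super Grassmannian\<close>

lemma qpow_mult: "qpow i * qpow j = qpow (i + j)"
  by (simp add: qpow_def mult_single)

lemma qpow_zero: "qpow 0 = 1"
  by (simp add: qpow_def)

lemma cq_scale_right_diff: "c *\<^sub>q (x - y :: 'a::cq_module) = c *\<^sub>q x - c *\<^sub>q y"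
  by (simp only: diff_conv_add_uminus cq_scale_right_distrib cq_scale_minus_right)

lemma cq_scale_left_diff: "(c - d) *\<^sub>q (x :: 'a::cq_module) = c *\<^sub>q x - d *\<^sub>q x"
  by (simp only: diff_conv_add_uminus cq_scale_left_distrib cq_scale_minus_left)

text \<open>Row \<open>l\<close> is at most 4, so \<open>a_l1\<close> and \<open>a_l2\<close> are
  even and all signs vanish. After reordering, the coefficient of \<open>a_l2 a_k1\<close> is 1 +
  q^-1 (q^-1 - q) = q^-2, as required.\<close>

lemma Gr_D_swap:
  assumes "l \<in> {1..4}" "k \<in> {1..5}" "l < k"
  shows "Gr_D k l = (- qpow (- 1)) *\<^sub>q Gr_D l k"
proof -
  let ?a = "glq_a :: nat \<Rightarrow> nat \<Rightarrow> (4, 1) glq"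
  have anti: "?a k 1 * ?a l 2 = ?a l 2 * ?a k 1"
    using glq_a_antidiagonal[of k 1 l 2, where 'm = 4 and 'n = 1] assms
    by (simp add: a_parity_def idx_parity_def ksign_def cq_scale_one)
  have diag: "?a k 2 * ?a l 1 = ?a l 1 * ?a k 2 - (qpow (- 1) - qpow 1) *\<^sub>q (?a l 2 * ?a k 1)"
    using glq_a_diagonal[of l 1 k 2, where 'm = 4 and 'n = 1] assms
    by (simp add: a_parity_def idx_parity_def ksign_def cq_scale_one anti algebra_simps
        del: One_nat_def)
  show ?thesis
    unfolding Gr_D_def anti diag
    by (simp add: cq_scale_right_diff cq_scale_left_diff cq_scale_scale cq_scale_minus_left
        right_diff_distrib qpow_mult qpow_zero cq_scale_one)
qed

text \<open>In an even row, \<open>a_k1 a_k2\<close> equals q^-1 \<open>a_k2 a_k1\<close>.\<close>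

lemma Gr_D_same:
  assumes "k \<in> {1..4}"
  shows "Gr_D k k = 0"
  using glq_a_row[of k 1 2, where 'm = 4 and 'n = 1] assms
  by (simp add: Gr_D_def a_parity_def idx_parity_def ksign_def)

text \<open>In the odd row, \<open>a_51 a_52\<close> equals -q \<open>a_52 a_51\<close>, so the two
  terms add up instead of cancelling.\<close>

lemma Gr_D_5_5: "Gr_D 5 5 = (1 + qpow (- 2)) *\<^sub>q (glq_a 5 1 * glq_a 5 2)"
  using glq_a_row[of 5 1 2, where 'm = 4 and 'n = 1]
  by (simp add: Gr_D_def a_parity_def idx_parity_def ksign_def cq_scale_scale cq_scale_left_distrib
      distrib_right qpow_mult qpow_zero cq_scale_one cq_scale_minus_left cq_scale_minus_right)

lemma Gr_D_in_Gr_q: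
  assumes "k \<in> {1..5}" "l \<in> {1..5}"
  shows "Gr_D k l \<in> Gr_q"
proof -
  have less: "Gr_D i j \<in> Gr_q" if "i \<in> {1..4}" "j \<in> {1..5}" "i < j" for i j
  proof -
    have "1 \<le> i \<and> i \<le> 4 \<and> j = 5 \<or> 1 \<le> i \<and> i < j \<and> j \<le> 4"
      using that by auto
    then show ?thesis
      unfolding Gr_q_def by (intro cq_subalgebra.base) blast
  qed
  show ?thesis
  proof (cases k l rule: linorder_cases)
    case equal
    show ?thesis
    proof (cases "k = 5")
      case True
      then show ?thesis
        using equal by (simp add: Gr_D_5_5) (simp add: Gr_q_def cq_subalgebra.intros)
    next
      case False
      then have "Gr_D k l = 0"
        using Gr_D_same[of k] equal assms by simp
      then show ?thesis
        by (simp add: Gr_q_def cq_subalgebra_zero)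
    qed
  next
    case greater
    then have "Gr_D k l = (- qpow (- 1)) *\<^sub>q Gr_D l k" "Gr_D l k \<in> Gr_q"
      using Gr_D_swap[of l k] less[of l k] assms by auto
    then show ?thesis
      by (simp add: Gr_q_def cq_subalgebra.scale)
  qed (use less assms in auto)
qed

context
  fixes \<Delta> :: "(4, 1) glq \<Rightarrow> ((4, 1) glq, (4, 1) glq) tensor"
  assumes comult: "glq_comultiplication \<Delta>"
begin

lemma comult_Gr_D:
  assumes "i \<in> {1..5}" "j \<in> {1..5}"
  shows "\<Delta> (Gr_D i j) = (\<Sum>k\<in>{1..5}. \<Sum>l\<in>{1..5}. ksign (a_parity 4 k 1) (a_parity 4 j l) *\<^sub>q
    ((glq_a i k * glq_a j l) \<otimes>\<^sub>q Gr_D k l))"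
proof -
  note lin = cq_algebra_homD(1)[OF comult_hom[OF comult]]
  have "a_parity 4 k 2 = a_parity 4 k 1" for k
    by (simp add: a_parity_def idx_parity_def)
  then show ?thesis
    using comult_a_mult_a[OF comult, of i 1 j 2] comult_a_mult_a[OF comult, of i 2 j 1] assms
    by (simp add: Gr_D_def cq_linear_diff[OF lin] cq_linearD(2)[OF lin] tensor_diff_right
        tensor_bilinear(4) cq_scale_right_diff cq_scale_scale mult.commute cq_scale_sum sum_subtractf)
qed

lemma comult_Gr_D_in_tensor_sub:
  assumes "i \<in> {1..5}" "j \<in> {1..5}"
  shows "\<Delta> (Gr_D i j) \<in> tensor_sub UNIV Gr_q"
  unfolding comult_Gr_D[OF assms] tensor_sub_def
  by (intro cq_span_sum cq_span.scale, fold tensor_sub_def, intro tensor_subI Gr_D_in_Gr_q)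

text \<open>\<open>Gr_D 5 5\<close> is \<open>1 + q\<^sup>-\<^sup>2\<close> times the last generator, and this scalar is not a unit, so the
  formula for \<open>\<Delta> (Gr_D 5 5)\<close> does not suffice. Instead, the terms of index \<open>(k, l)\<close> and \<open>(l, k)\<close> in its coproduct combine to a multiple of \<open>Gr_D k l\<close>.\<close>

lemma comult_a51_a52_in_tensor_sub: "\<Delta> (glq_a 5 1 * glq_a 5 2) \<in> tensor_sub UNIV Gr_q"
proof -
  let ?a = "glq_a :: nat \<Rightarrow> nat \<Rightarrow> (4, 1) glq"
  define f where "f k l = ksign (a_parity 4 k 1) (a_parity 4 5 l) *\<^sub>q
    ((?a 5 k * ?a 5 l) \<otimes>\<^sub>q (?a k 1 * ?a l 2))" for k l
  \<comment> \<open>For \<open>k\<close> at most 4 the entry \<open>a_5k\<close> is odd and squares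
    to zero; for \<open>k = 5\<close> the second tensor factor is the generator
    \<open>a_51 a_52\<close>.\<close>
  have diag: "f k k \<in> tensor_sub UNIV Gr_q" if "k \<in> {1..5}" for k
  proof (cases "k = 5")
    case True
    have "?a 5 1 * ?a 5 2 \<in> Gr_q"
      by (simp add: Gr_q_def cq_subalgebra.base)
    then show ?thesis
      using tensor_subI[of "?a 5 1 * ?a 5 2" Gr_q "?a 5 5 * ?a 5 5"]
      by (simp add: True f_def tensor_sub_def cq_span.scale)
  next
    case False
    then have "?a 5 k * ?a 5 k = 0"
      using glq_a_odd_square[of 5 k, where 'm = 4 and 'n = 1] that
      by (simp add: a_parity_def idx_parity_def)
    then show ?thesis
      by (simp add: f_def tensor_sub_def cq_span.zero)
  qed
  have pair: "f k l + f l k \<in> tensor_sub UNIV Gr_q"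
    if kl: "k \<in> {1..5}" "l \<in> {1..5}" "k < l" for k l
  proof -
    have row: "?a 5 k * ?a 5 l
        = (ksign (a_parity 4 5 k) (a_parity 4 5 l) * qpow 1) *\<^sub>q (?a 5 l * ?a 5 k)"
      using glq_a_row[of 5 k l, where 'm = 4 and 'n = 1] kl by (simp add: idx_parity_def)
    \<comment> \<open>Since k < l \<le> 5, the entry \<open>a_k2\<close> is even, so this
      antidiagonal pair commutes without a sign.\<close>
    have anti: "?a l 1 * ?a k 2 = ?a k 2 * ?a l 1"
      using glq_a_antidiagonal[of l 1 k 2, where 'm = 4 and 'n = 1] kl
      by (simp add: a_parity_def idx_parity_def ksign_def cq_scale_one)
    define c where "c = ksign (a_parity 4 5 k) (a_parity 4 5 l)"
    \<comment> \<open>\<open>a_k1\<close> is even, while \<open>a_5k\<close> is odd. As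
      \<open>a_l1\<close> and \<open>a_5l\<close> have opposite parities, exactly one of the second
      sign and \<open>c\<close> is -1.\<close>
    have signs: "ksign (a_parity 4 k 1) d = 1"
      "ksign (a_parity 4 l 1) (a_parity 4 5 k) = - c" for d
      using kl by (auto simp: c_def a_parity_def idx_parity_def ksign_def)
    have cancel: "qpow (- 1) * (c * qpow 1) = c"
      by (simp add: mult.left_commute qpow_mult qpow_zero)
    \<comment> \<open>By \<open>row\<close>, both sides are written with \<open>a_5l a_5k\<close> in
      the first factor; \<open>f l k\<close> then supplies the term of \<open>Gr_D k l\<close> with
      coefficient -q^-1.\<close>
    have "f k l + f l k = (?a 5 k * ?a 5 l) \<otimes>\<^sub>q Gr_D k l"
      unfolding f_def Gr_D_def row signs anti c_def[symmetric]
      by (simp only: tensor_diff_right tensor_bilinear cq_scale_scale cq_scale_right_diff cancel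
          cq_scale_minus_left cq_scale_one add_uminus_conv_diff mult_1_left)
    then show ?thesis
      using kl by (simp add: tensor_subI Gr_D_in_Gr_q)
  qed
  have expand: "\<Delta> (?a 5 1 * ?a 5 2) = (\<Sum>k\<in>{1..5}. \<Sum>l\<in>{1..5}. f k l)"
    using comult_a_mult_a[OF comult, of 5 1 5 2] by (simp add: f_def)
  show ?thesis
    unfolding expand tensor_sub_def
    by (rule sum_square_in_span; fold tensor_sub_def; rule diag pair; assumption)
qed

end

text \<open>The two families of \<open>Gr_D\<close> merge because the arguments about them work for
  all indices from 1 to 5; only the last generator is a case of its own.\<close>

lemma Gr_q_generator_cases:
  assumes "x \<in> {Gr_D i j |i j. 1 \<le> i \<and> i < j \<and> j \<le> 4} \<union> {Gr_D i 5 |i. 1 \<le> i \<and> i \<le> 4}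
    \<union> {glq_a 5 1 * glq_a 5 2}"
  obtains i j where "x = Gr_D i j" "i \<in> {1..5}" "j \<in> {1..5}" | "x = glq_a 5 1 * glq_a 5 2"
proof -
  have "(\<exists>i j. x = Gr_D i j \<and> i \<in> {1..5} \<and> j \<in> {1..5}) \<or> x = glq_a 5 1 * glq_a 5 2"
    using assms by (elim UnE CollectE exE conjE; simp; (rule disjI1)?; force)
  then show ?thesis using that by blast
qed

text \<open>Columns 1 and 2 are both even, so the parity of an entry there depends on its row alone
  and the two products in \<open>Gr_D i j\<close> have equal degree.\<close>

lemma Gr_q_generator_homogeneous:
  assumes "x \<in> {Gr_D i j |i j. 1 \<le> i \<and> i < j \<and> j \<le> 4} \<union> {Gr_D i 5 |i. 1 \<le> i \<and> i \<le> 4}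
    \<union> {glq_a 5 1 * glq_a 5 2}"
  shows "\<exists>d. spart d x = x"
proof -
  have hom: "spart (a_parity 4 i 1 + a_parity 4 j 1) (glq_a i k * glq_a j l)
      = (glq_a i k * glq_a j l :: (4, 1) glq)"
    if "i \<in> {1..5}" "j \<in> {1..5}" "k \<in> {1, 2}" "l \<in> {1, 2}" for i j k l
  proof (rule spart_mult_homogeneous)
    have "a_parity 4 i k = a_parity 4 i 1" "a_parity 4 j l = a_parity 4 j 1"
      using that by (auto simp: a_parity_def idx_parity_def)
    then show "spart (a_parity 4 i 1) (glq_a i k) = (glq_a i k :: (4, 1) glq)"
      "spart (a_parity 4 j 1) (glq_a j l) = (glq_a j l :: (4, 1) glq)"
      using glq_a_homogeneous[of i k, where 'm = 4 and 'n = 1]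
        glq_a_homogeneous[of j l, where 'm = 4 and 'n = 1] that by auto
  qed
  show ?thesis
    using assms
  proof (cases rule: Gr_q_generator_cases)
    case (1 i j)
    define d where "d = a_parity 4 i 1 + a_parity 4 j 1"
    have "spart d (glq_a i 1 * glq_a j 2) = (glq_a i 1 * glq_a j 2 :: (4, 1) glq)"
      "spart d (glq_a i 2 * glq_a j 1) = (glq_a i 2 * glq_a j 1 :: (4, 1) glq)"
      unfolding d_def using 1 by (intro hom; simp)+
    then have "spart d x = x"
      unfolding 1(1) Gr_D_def by (simp only: cq_linear_diff[OF cq_linear_spart] spart_scale)
    then show ?thesis ..
  next
    case 2
    then show ?thesis using hom[of 5 5 1 2] by auto
  qed
qed

text \<open>Brings the Grassmannian within reach of \<open>comult_coassoc\<close> and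
  \<open>comult_counit\<close>.\<close>

lemma Gr_q_subset:
  "x \<in> Gr_q \<Longrightarrow> x \<in> cq_subalgebra {glq_a i j |i j. i \<in> {1..5} \<and> j \<in> {1..5}}"
  unfolding Gr_q_def
proof (erule cq_subalgebra_least, rule subsetI, erule Gr_q_generator_cases)
  let ?M = "cq_subalgebra {glq_a i j :: (4, 1) glq |i j. i \<in> {1..5} \<and> j \<in> {1..5}}"
  have a: "glq_a i j \<in> ?M" if "i \<in> {1..5}" "j \<in> {1..5}" for i j
    using that by (intro cq_subalgebra.base) blast
  show "x \<in> ?M" if "x = Gr_D i j" "i \<in> {1..5}" "j \<in> {1..5}" for x i j
    unfolding that(1) Gr_D_def
    using that by (intro cq_subalgebra_diff cq_subalgebra.scale cq_subalgebra.mult a) simp_all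
  show "x \<in> ?M" if "x = glq_a 5 1 * glq_a 5 2" for x
    unfolding that by (intro cq_subalgebra.mult a) simp_all
qed

theorem proposition6p5:
  fixes \<Delta> :: "(4, 1) glq \<Rightarrow> ((4, 1) glq, (4, 1) glq) tensor"
    and \<epsilon> :: "(4, 1) glq \<Rightarrow> laurent"
  assumes "glq_comultiplication \<Delta>"
    and "glq_counit \<epsilon>"
  shows "restricts_to_left_coaction \<Delta> \<epsilon> Gr_q \<Delta>"
  unfolding restricts_to_left_coaction_def
proof (intro conjI ballI)
  fix x :: "(4, 1) glq"
  assume x: "x \<in> Gr_q"
  show "\<Delta> x \<in> tensor_sub UNIV Gr_q"
    unfolding Gr_q_def
  proof (rule cq_algebra_hom_subalgebra_into_tensor_sub[OF x[unfolded Gr_q_def]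
        comult_hom[OF assms(1)] Gr_q_generator_homogeneous], assumption, fold Gr_q_def,
      erule Gr_q_generator_cases)
    show "\<Delta> y \<in> tensor_sub UNIV Gr_q" if "y = Gr_D i j" "i \<in> {1..5}" "j \<in> {1..5}" for y i j
      using comult_Gr_D_in_tensor_sub[OF assms(1)] that by simp
    show "\<Delta> y \<in> tensor_sub UNIV Gr_q" if "y = glq_a 5 1 * glq_a 5 2" for y
      using comult_a51_a52_in_tensor_sub[OF assms(1)] that by simp
  qed
  note M = Gr_q_subset[OF x]
  show "tassoc (tmap \<Delta> id (\<Delta> x)) = tmap id \<Delta> (\<Delta> x)"
    using comult_coassoc[OF assms(1), of x] M by simp
  show "tlift (\<lambda>h a. \<epsilon> h *\<^sub>q a) (\<Delta> x) = x"
    using comult_counit[OF assms(1) _ assms(2), of x] M by simp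
next
  show "superalgebra_hom_on Gr_q \<Delta>"
    using assms(1) by (simp add: glq_comultiplication_def superalgebra_hom_on_def)
qed

end
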